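(* Let $\Lambda$ be a non-empty time-consistent family of probability measures equivalent to $P$, let $\xi\in L^1(\mathcal{F}_T;\mathbb{R})$, and let $Y_t=G(\xi|\mathcal{F}_t):=\inf_{Q\in\Lambda}E^Q[\xi\mid\mathcal{F}_t]$ for $0\le t\le T$. Then $Y$ solves the backward stochastic difference equation with terminal value $Y_T=\xi$ and driver $$f(\omega,t,z)=\inf_{\{\theta:\,Q^\theta\in\Lambda\}}\{z^*\theta_t\},$$ i.e. there is an adapted $\mathbb{R}^m$-valued process $Z$ such that for all $0\le t\le T$, $Y_t=\xi+\sum_{t\le u<T}f(u,Z_u)-\sum_{t\le u<T}Z_u^*M_{u+1}$ $P$-a.s.
   Context: Setting: $T$ is a positive integer, $m\ge 1$, and $X=(X_t)_{0\le t\le T}$ is a stochastic process with values in the set of standard basis vectors $\{e_1,\dots,e_m\}$ of $\mathbb{R}^m$ on a probability space $(\Omega,\mathcal{F},P)$; $\mathcal{F}_t$ is the completion of $\sigma(X_0,\dots,X_t)$, $\mathcal{F}=\mathcal{F}_T$, and $\mathcal{F}_0$ is $P$-trivial. $M_t=X_t-E[X_t\mid\mathcal{F}_{t-1}]$ for $t=1,\dots,T$. $[\cdot]^*$ denotes transposition; infima of random variables are essential infima. $Q$-vector process: with $\mathcal{Q}_t=\{i:P(X_{t+1}=e_i\mid\mathcal{F}_t)>0\}$, an adapted integrable $\mathbb{R}^m$-valued process $\theta=(\theta_t)_{0\le t<T}$ such that $\sum_j\langle\theta_t,e_j\rangle=0$ and $\langle\theta_t,e_i\rangle=0$ for all $i\notin\mathcal{Q}_t$.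 Measures $Q^\theta$: let $\psi_t=E[M_{t+1}M_{t+1}^*\mid\mathcal{F}_t]$ with Moore–Penrose pseudoinverse $\psi_t^+$. Every probability measure $Q\sim P$ on $\mathcal{F}_T$ can be written as $Q=Q^\theta$, where $\frac{dQ^\theta}{dP}=\prod_{0\le s<T}(1+\theta_s^*\psi_s^+M_{s+1})$ for a $Q$-vector process $\theta$; one has $E^{Q^\theta}[M_{t+1}\mid\mathcal{F}_t]=\theta_t$. The infimum defining $f$ runs over such $Q$-vector processes. A family $\Lambda$ of probability measures is time-consistent if for any $Q,Q'\in\Lambda$, any $t$ and any $A\in\mathcal{F}_t$, the measure $Q''(B)=E_Q\big[I_A E_{Q'}[I_B\mid\mathcal{F}_t]+I_{A^c}I_B\big]$ belongs to $\Lambda$. *)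

theory Defs
  imports "HOL-Probability.Probability"
begin

section \<open>Filtration and driving martingale\<close>

definition natural_sigma ::
  "'a measure \<Rightarrow> (nat \<Rightarrow> 'a \<Rightarrow> 'b::topological_space) \<Rightarrow> nat \<Rightarrow> 'a measure" where
  "natural_sigma P X t =
     sigma (space P) (\<Union>s\<in>{..t}. {X s -` B \<inter> space P | B. B \<in> sets borel})"

definition filt ::
  "'a measure \<Rightarrow> (nat \<Rightarrow> 'a \<Rightarrow> 'b::topological_space) \<Rightarrow> nat \<Rightarrow> 'a measure" where
  "filt P X t = completion (restr_to_subalg P (natural_sigma P X t))"

definition vec_cond_exp ::
  "'a measure \<Rightarrow> 'a measure \<Rightarrow> ('a \<Rightarrow> real^'m) \<Rightarrow> 'a \<Rightarrow> real^'m" where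
  "vec_cond_exp P F g \<omega> = (\<chi> i. real_cond_exp P F (\<lambda>\<omega>. g \<omega> $ i) \<omega>)"

text \<open>Only the values of \<open>M_diff P X t\<close> for \<open>t \<ge> 1\<close> are meaningful.\<close>

definition M_diff ::
  "'a measure \<Rightarrow> (nat \<Rightarrow> 'a \<Rightarrow> real^'m) \<Rightarrow> nat \<Rightarrow> 'a \<Rightarrow> real^'m" where
  "M_diff P X t \<omega> = X t \<omega> - vec_cond_exp P (filt P X (t - 1)) (X t) \<omega>"

locale finite_state_process = prob_space P
  for P :: "'a measure" and X :: "nat \<Rightarrow> 'a \<Rightarrow> real^'m" and T :: nat +
  assumes T_pos: "T \<ge> 1"
    and X_measurable: "t \<le> T \<Longrightarrow> X t \<in> borel_measurable P"
    and X_basis: "t \<le> T \<Longrightarrow> \<omega> \<in> space P \<Longrightarrow> \<exists>i. X t \<omega> = axis i 1"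
    and sets_P: "sets P = sets (filt P X T)"
    and F0_trivial: "A \<in> sets (filt P X 0) \<Longrightarrow> measure P A = 0 \<or> measure P A = 1"


section \<open>Vector processes and the measures they induce\<close>

definition moore_penrose :: "real^'n^'m \<Rightarrow> real^'m^'n" where
  "moore_penrose A = (THE B. A ** B ** A = A \<and> B ** A ** B = B \<and>
     transpose (A ** B) = A ** B \<and> transpose (B ** A) = B ** A)"

definition psi ::
  "'a measure \<Rightarrow> (nat \<Rightarrow> 'a \<Rightarrow> real^'m) \<Rightarrow> nat \<Rightarrow> 'a \<Rightarrow> real^'m^'m" where
  "psi P X t \<omega> = (\<chi> i j. real_cond_exp P (filt P X t)
     (\<lambda>\<omega>. M_diff P X (Suc t) \<omega> $ i * M_diff P X (Suc t) \<omega> $ j) \<omega>)"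

definition possible_jumps ::
  "'a measure \<Rightarrow> (nat \<Rightarrow> 'a \<Rightarrow> real^'m) \<Rightarrow> nat \<Rightarrow> 'a \<Rightarrow> 'm set" where
  "possible_jumps P X t \<omega> =
     {i. real_cond_exp P (filt P X t)
           (indicator {\<omega> \<in> space P. X (Suc t) \<omega> = axis i 1}) \<omega> > 0}"

definition Q_vector_process ::
  "'a measure \<Rightarrow> (nat \<Rightarrow> 'a \<Rightarrow> real^'m) \<Rightarrow> nat \<Rightarrow> (nat \<Rightarrow> 'a \<Rightarrow> real^'m) \<Rightarrow> bool" where
  "Q_vector_process P X T \<theta> \<longleftrightarrow>
     (\<forall>t<T. \<theta> t \<in> borel_measurable (filt P X t) \<and> integrable P (\<theta> t) \<and>
        (AE \<omega> in P. (\<Sum>j\<in>UNIV. \<theta> t \<omega> $ j) = 0) \<and>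
        (AE \<omega> in P. \<forall>i. i \<notin> possible_jumps P X t \<omega> \<longrightarrow> \<theta> t \<omega> $ i = 0))"

definition Q_density ::
  "'a measure \<Rightarrow> (nat \<Rightarrow> 'a \<Rightarrow> real^'m) \<Rightarrow> nat \<Rightarrow> (nat \<Rightarrow> 'a \<Rightarrow> real^'m) \<Rightarrow> 'a \<Rightarrow> real" where
  "Q_density P X T \<theta> \<omega> =
     (\<Prod>s<T. 1 + \<theta> s \<omega> \<bullet> (moore_penrose (psi P X s \<omega>) *v M_diff P X (Suc s) \<omega>))"

text \<open>
  The function \<open>ennreal\<close> cuts off negative values.  As the product has \<open>P\<close>-expectation one, the
  cut-off measure has total mass one only if the product is almost surely nonnegative, so
  \<open>Q_measure P X T \<theta>\<close> can belong to a family of probability measures only if the product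
  really is its density.
\<close>

definition Q_measure ::
  "'a measure \<Rightarrow> (nat \<Rightarrow> 'a \<Rightarrow> real^'m) \<Rightarrow> nat \<Rightarrow> (nat \<Rightarrow> 'a \<Rightarrow> real^'m) \<Rightarrow> 'a measure" where
  "Q_measure P X T \<theta> = density P (\<lambda>\<omega>. ennreal (Q_density P X T \<theta> \<omega>))"


section \<open>Families of measures\<close>

definition equivalent_prob :: "'a measure \<Rightarrow> 'a measure \<Rightarrow> bool" where
  "equivalent_prob P Q \<longleftrightarrow> prob_space Q \<and> sets Q = sets P \<and>
     absolutely_continuous P Q \<and> absolutely_continuous Q P"

definition time_consistent ::
  "'a measure \<Rightarrow> (nat \<Rightarrow> 'a \<Rightarrow> real^'m) \<Rightarrow> nat \<Rightarrow> 'a measure set \<Rightarrow> bool" where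
  "time_consistent P X T \<Lambda> \<longleftrightarrow>
     (\<forall>Q\<in>\<Lambda>. \<forall>Q'\<in>\<Lambda>. \<forall>t\<le>T. \<forall>A\<in>sets (filt P X t). \<exists>Q''\<in>\<Lambda>. \<forall>B\<in>sets P.
        measure Q'' B =
          (\<integral>\<omega>. indicator A \<omega> * real_cond_exp Q' (filt P X t) (indicator B) \<omega>
               + indicator (space P - A) \<omega> * indicator B \<omega> \<partial>Q))"


section \<open>Essential infima, nonlinear expectation and driver\<close>

definition is_ess_inf :: "'a measure \<Rightarrow> ('a \<Rightarrow> real) set \<Rightarrow> ('a \<Rightarrow> real) \<Rightarrow> bool" where
  "is_ess_inf P S g \<longleftrightarrow> g \<in> borel_measurable P \<and>
     (\<forall>h\<in>S. AE \<omega> in P. g \<omega> \<le> h \<omega>) \<and>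
     (\<forall>g'\<in>borel_measurable P. (\<forall>h\<in>S. AE \<omega> in P. g' \<omega> \<le> h \<omega>) \<longrightarrow> (AE \<omega> in P. g' \<omega> \<le> g \<omega>))"

text \<open>
  Essential infima are determined only up to null sets, so the value process and the driver are
  described by the property of being (adapted) versions of the respective essential infima.
  For the driver a version is chosen separately for every deterministic \<open>z\<close>.
\<close>

definition is_nonlinear_expectation ::
  "'a measure \<Rightarrow> (nat \<Rightarrow> 'a \<Rightarrow> real^'m) \<Rightarrow> nat \<Rightarrow> 'a measure set \<Rightarrow> ('a \<Rightarrow> real)
     \<Rightarrow> (nat \<Rightarrow> 'a \<Rightarrow> real) \<Rightarrow> bool" where
  "is_nonlinear_expectation P X T \<Lambda> \<xi> Y \<longleftrightarrow>
     (\<forall>t\<le>T. Y t \<in> borel_measurable (filt P X t) \<and>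
        is_ess_inf P {real_cond_exp Q (filt P X t) \<xi> | Q. Q \<in> \<Lambda>} (Y t))"

definition is_driver ::
  "'a measure \<Rightarrow> (nat \<Rightarrow> 'a \<Rightarrow> real^'m) \<Rightarrow> nat \<Rightarrow> 'a measure set
     \<Rightarrow> ('a \<Rightarrow> nat \<Rightarrow> real^'m \<Rightarrow> real) \<Rightarrow> bool" where
  "is_driver P X T \<Lambda> f \<longleftrightarrow>
     (\<forall>t<T. \<forall>z. (\<lambda>\<omega>. f \<omega> t z) \<in> borel_measurable (filt P X t) \<and>
        is_ess_inf P
          {\<lambda>\<omega>. z \<bullet> \<theta> t \<omega> | \<theta>. Q_vector_process P X T \<theta> \<and> Q_measure P X T \<theta> \<in> \<Lambda>}
          (\<lambda>\<omega>. f \<omega> t z))"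

end

theory Submission
  imports Defs
begin

text \<open>
  As \<open>X\<close> takes finitely many values, every random variable is almost surely a function of the path
  of \<open>X\<close>, hence essentially bounded, and an \<open>F\<^sub>t\<^sub>+\<^sub>1\<close>-measurable variable is linear in \<open>X\<^sub>t\<^sub>+\<^sub>1\<close> with
  \<open>F\<^sub>t\<close>-measurable coefficients.  Therefore \<open>Y\<^sub>t\<^sub>+\<^sub>1 = E[Y\<^sub>t\<^sub>+\<^sub>1 | F\<^sub>t] + Z\<^sub>t \<bullet> M\<^sub>t\<^sub>+\<^sub>1\<close>, and the conditional
  expectation of \<open>Y\<^sub>t\<^sub>+\<^sub>1\<close> under the measure with vector process \<open>\<theta>\<close> is
  \<open>E[Y\<^sub>t\<^sub>+\<^sub>1 | F\<^sub>t] + Z\<^sub>t \<bullet> \<theta>\<^sub>t\<close>.  Pasting near-minimisers on the finitely many atoms of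
  \<open>F\<^sub>t\<^sub>+\<^sub>1\<close> gives the dynamic programming principle \<open>Y\<^sub>t = inf E\<^sup>Q[Y\<^sub>t\<^sub>+\<^sub>1 | F\<^sub>t]\<close>, which then reads
  \<open>Y\<^sub>t = Y\<^sub>t\<^sub>+\<^sub>1 + f(t, Z\<^sub>t) - Z\<^sub>t \<bullet> M\<^sub>t\<^sub>+\<^sub>1\<close>.
\<close>

section \<open>The pseudoinverse of a covariance matrix\<close>

text \<open>The main obstacle is the random argument of the driver. The one-step equation is proved
  as two inequalities. The upper bound on Y is where time consistency enters: the infimum over
  \<Lambda> need not be attained, and near-minimisers differ from atom to atom, so one member of
  \<Lambda> that is nearly optimal on all atoms has to be produced. The lower bound combines the
  tower property with the fact that every member of \<Lambda> comes from a vector process. That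
  representation writes a density as a telescoping product of ratios of conditional densities; it
  starts at one because F_0 is trivial. The pseudoinverse in the definition is handled by a closed
  form, since the conditional law of the next state is a distribution on the basis vectors.\<close>

lemma moore_penrose_eqI:
  fixes A :: "real^'n^'m"
  assumes B: "A ** B ** A = A" "B ** A ** B = B"
    "transpose (A ** B) = A ** B" "transpose (B ** A) = B ** A"
  shows "moore_penrose A = B"
  unfolding moore_penrose_def
proof (rule the_equality)
  fix C assume "A ** C ** A = A \<and> C ** A ** C = C \<and>
     transpose (A ** C) = A ** C \<and> transpose (C ** A) = C ** A"
  then have C: "A ** C ** A = A" "C ** A ** C = C"
    "transpose (A ** C) = A ** C" "transpose (C ** A) = C ** A" by auto
  \<comment> \<open>\<open>A ** B\<close> and \<open>A ** C\<close> are both the orthogonal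
    projection onto the column space of \<open>A\<close>; symmetry and the absorption rules turn one
    into the other. Below, \<open>B ** A\<close> and \<open>C ** A\<close> are both the orthogonal
    projection onto the row space.\<close>
  have "A ** B = transpose (A ** C ** (A ** B))"
    by (metis B(1,3) C(1,3) matrix_mul_assoc)
  also have "\<dots> = A ** B ** (A ** C)"
    by (metis B(3) C(3) matrix_transpose_mul)
  also have "\<dots> = A ** C" by (metis B(1) matrix_mul_assoc)
  finally have AB: "A ** B = A ** C" .
  have "B ** A = transpose (B ** A ** (C ** A))"
    by (metis B(4) C(1) matrix_mul_assoc)
  also have "\<dots> = C ** A ** (B ** A)"
    by (metis B(4) C(4) matrix_transpose_mul)
  also have "\<dots> = C ** A" by (metis B(1) matrix_mul_assoc)
  finally have BA: "B ** A = C ** A" .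
  show "C = B" by (metis AB BA B(2) C(2) matrix_mul_assoc)
qed (use B in auto)

text \<open>
  The pseudoinverse of the covariance matrix of a distribution \<open>p\<close> on the basis vectors is
  \<open>C D C\<close>, where \<open>D\<close> inverts the diagonal on the support of \<open>p\<close> and \<open>C\<close> is the orthogonal
  projection onto the vectors supported there with vanishing coordinate sum.
\<close>

lemma moore_penrose_covariance:
  fixes p :: "'m::finite \<Rightarrow> real"
  assumes p: "\<And>i. p i \<ge> 0" "(\<Sum>i\<in>UNIV. p i) = 1"
  defines "A \<equiv> (\<chi> i j. (if i = j then p i else 0) - p i * p j) :: real^'m^'m"
  shows "transpose (moore_penrose A) = moore_penrose A"
    and "\<And>v. (\<Sum>j\<in>UNIV. v $ j) = 0 \<Longrightarrow> (\<And>i. p i = 0 \<Longrightarrow> v $ i = 0) \<Longrightarrow>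
           A *v (moore_penrose A *v v) = v"
proof -
  let ?e = "\<lambda>i. if p i = 0 then 0 else 1 :: real"
  let ?d = "\<lambda>i. if p i = 0 then 0 else 1 / p i :: real"
  let ?n = "\<Sum>i\<in>UNIV. ?e i"
  \<comment> \<open>\<open>?e\<close> is the indicator of the support of \<open>p\<close> and
    \<open>?n\<close> its size. \<open>S\<close> will be \<open>A ** D\<close>, an oblique
    projection along \<open>p\<close> with the same range as \<open>C\<close>; hence
    \<open>S ** C = C\<close>, and multiplying by \<open>C\<close> makes the projection
    orthogonal.\<close>
  define C :: "real^'m^'m" where "C = (\<chi> i j. (if i = j then ?e i else 0) - ?e i * ?e j / ?n)"
  define D :: "real^'m^'m" where "D = (\<chi> i j. if i = j then ?d i else 0)"
  define S :: "real^'m^'m" where "S = (\<chi> i j. (if i = j then ?e i else 0) - p i * ?e j)"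
  have "\<exists>i. p i \<noteq> 0" using p(2) by (metis sum.neutral zero_neq_one)
  then have n: "?n \<noteq> 0" by (subst sum_nonneg_eq_0_iff) auto
  have pe: "p i * ?e i = p i" "?e i * p i = p i" "?e i * ?e i = ?e i" "p i * ?d i = ?e i" for i by auto
  have psum: "(\<Sum>i\<in>UNIV. p i * ?e i) = 1" using p(2) by (simp only: pe)
  have tA: "transpose A = A" and tC: "transpose C = C" and tD: "transpose D = D"
    by (auto simp: A_def C_def D_def transpose_def vec_eq_iff)
  \<comment> \<open>Every factor below is a diagonal matrix minus one of rank at most one, so a
    single product rule reduces each matrix identity to the value of one scalar sum.\<close>
  have mm: "(\<chi> i j. (if i = j then a i else 0) - b i * c j) ** (\<chi> i j. (if i = j then a' i else 0) - b' i * c' j)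
     = (\<chi> i j. (if i = j then a i * a' i else 0) - b i * c j * a' j - a i * b' i * c' j
          + b i * (\<Sum>k\<in>UNIV. c k * b' k) * c' j)" for a b c a' b' c' :: "'m \<Rightarrow> real"
  proof -
    have "(\<Sum>k\<in>UNIV. ((if i = k then a i else 0) - b i * c k) * ((if k = j then a' k else 0) - b' k * c' j))
      = (if i = j then a i * a' i else 0) - b i * c j * a' j - a i * b' i * c' j
          + b i * (\<Sum>k\<in>UNIV. c k * b' k) * c' j" for i j
    proof -
      have "(\<Sum>k\<in>UNIV. ((if i = k then a i else 0) - b i * c k) * ((if k = j then a' k else 0) - b' k * c' j))
       = (\<Sum>k\<in>UNIV. (if i = k then a i * (if k = j then a' k else 0) else 0) - (if k = j then b i * c k * a' k else 0)
           - (if i = k then a i * b' k * c' j else 0) + b i * (c k * b' k) * c' j)"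
        by (intro sum.cong) (auto simp: algebra_simps)
      also have "\<dots> = (if i = j then a i * a' i else 0) - b i * c j * a' j - a i * b' i * c' j
          + b i * (\<Sum>k\<in>UNIV. c k * b' k) * c' j"
        by (simp add: sum.distrib sum_subtractf sum_distrib_left sum_distrib_right sum.delta sum.delta')
      finally show ?thesis .
    qed
    then show ?thesis by (simp add: matrix_matrix_mult_def vec_eq_iff)
  qed
  have A_alt: "A = (\<chi> i j. (if i = j then p i else 0) - p i * p j)" by (simp add: A_def)
  have C_alt: "C = (\<chi> i j. (if i = j then ?e i else 0) - ?e i * (?e j / ?n))" by (simp add: C_def)
  have D_alt: "D = (\<chi> i j. (if i = j then ?d i else 0) - 0 * 0)" by (simp add: D_def)
  have S_alt: "S = (\<chi> i j. (if i = j then ?e i else 0) - p i * ?e j)" by (simp add: S_def)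
  have AC: "A ** C = A"
    unfolding A_alt C_alt mm psum by (auto simp: vec_eq_iff)
  have AD: "A ** D = S"
    unfolding A_alt D_alt S_alt mm by (auto simp: vec_eq_iff)
  have en: "(\<Sum>i\<in>UNIV. ?e i * ?e i) = ?n" by (simp only: pe)
  have SC: "S ** C = C"
    unfolding S_alt C_alt mm en using n by (auto simp: vec_eq_iff)
  have en2: "(\<Sum>i\<in>UNIV. ?e i / ?n * ?e i) = 1"
    using n en by (simp flip: sum_divide_distrib)
  have CC: "C ** C = C"
    unfolding C_alt mm en2 by (auto simp: vec_eq_iff)
  define B where "B = C ** D ** C"
  have AB: "A ** B = C" unfolding B_def by (metis AC AD SC matrix_mul_assoc)
  have tB: "transpose B = B" unfolding B_def
    by (simp add: matrix_transpose_mul tC tD matrix_mul_assoc)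
  have BA: "B ** A = C" by (metis AB matrix_transpose_mul tA tB tC)
  have CA: "C ** A = A" by (metis AC matrix_transpose_mul tA tC)
  have CB: "C ** B = B" unfolding B_def by (metis CC matrix_mul_assoc)
  have MP: "moore_penrose A = B"
    by (rule moore_penrose_eqI) (simp_all add: AB BA CA CB tC)
  show "transpose (moore_penrose A) = moore_penrose A" by (simp add: MP tB)
  fix v :: "real^'m" assume v: "(\<Sum>j\<in>UNIV. v $ j) = 0" "\<And>i. p i = 0 \<Longrightarrow> v $ i = 0"
  have "(\<Sum>j\<in>UNIV. ?e j * v $ j) = (\<Sum>j\<in>UNIV. v $ j)" using v(2) by (intro sum.cong) auto
  then have ev: "(\<Sum>j\<in>UNIV. ?e j * v $ j) = 0" using v(1) by simp
  have "(C *v v) $ i = v $ i" for i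
  proof -
    have "(C *v v) $ i = (\<Sum>j\<in>UNIV. (if i = j then ?e i * v $ j else 0) - ?e i / ?n * (?e j * v $ j))"
      unfolding C_def matrix_vector_mult_def vec_lambda_beta by (intro sum.cong) (auto simp: algebra_simps)
    also have "\<dots> = v $ i"
      using v(2)[of i] by (simp only: sum_subtractf sum_distrib_left[symmetric] ev sum.delta'[OF finite]) simp
    finally show ?thesis .
  qed
  then have "C *v v = v" by (simp add: vec_eq_iff)
  then show "A *v (moore_penrose A *v v) = v"
    by (simp add: MP matrix_vector_mul_assoc AB)
qed

section \<open>Random variables as functions of the path\<close>

text \<open>Padding with zeros after time \<open>t\<close> gives all histories the same type: an
  earlier history is a function of a later one, and a one-step continuation is a function
  update.\<close>

definition (in finite_state_process) history :: "nat \<Rightarrow> 'a \<Rightarrow> nat \<Rightarrow> real^'m" where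
  "history t \<omega> = (\<lambda>s. if s \<le> t then X s \<omega> else 0)"

text \<open>
  Unlike measurability with respect to \<open>filt P X t\<close>, this notion is invariant under modification
  on any \<open>P\<close>-null set: \<open>filt P X t\<close> is completed only by subsets of null sets from \<open>\<sigma>(X\<^sub>0, \<dots>, X\<^sub>t)\<close>.
\<close>

definition (in finite_state_process) adapted :: "nat \<Rightarrow> ('a \<Rightarrow> 'c) \<Rightarrow> bool" where
  "adapted t g \<longleftrightarrow> (\<exists>\<gamma>. AE \<omega> in P. g \<omega> = \<gamma> (history t \<omega>))"

context finite_state_process
begin

section \<open>The filtration: inclusions and completeness\<close>

lemma space_natural_sigma: "space (natural_sigma P X t) = space P"
  by (simp add: natural_sigma_def space_measure_of_conv)

lemma sets_natural_sigma:
  "sets (natural_sigma P X t) =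
     sigma_sets (space P) (\<Union>s\<in>{..t}. {X s -` B \<inter> space P | B. B \<in> sets borel})"
  unfolding natural_sigma_def by (rule sets_measure_of) auto

lemma subalgebra_natural_sigma: "t \<le> T \<Longrightarrow> subalgebra P (natural_sigma P X t)"
  unfolding subalgebra_def space_natural_sigma sets_natural_sigma
  by (auto intro!: sets.sigma_sets_subset measurable_sets[OF X_measurable])

lemma sets_natural_sigma_mono: "s \<le> t \<Longrightarrow> sets (natural_sigma P X s) \<subseteq> sets (natural_sigma P X t)"
  unfolding sets_natural_sigma by (rule sigma_sets_mono'') force+

lemma space_filt: "space (filt P X t) = space P"
  by (simp add: filt_def space_restr_to_subalg)

lemma natural_sigma_subset_filt: "t \<le> T \<Longrightarrow> sets (natural_sigma P X t) \<subseteq> sets (filt P X t)"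
  unfolding filt_def
  by (metis sets_completionI_sets sets_restr_to_subalg subalgebra_natural_sigma subsetI)

lemma sets_filt_mono:
  assumes "s \<le> t" "t \<le> T"
  shows "sets (filt P X s) \<subseteq> sets (filt P X t)"
proof -
  have sub: "subalgebra P (natural_sigma P X s)" "subalgebra P (natural_sigma P X t)"
    using assms by (auto intro: subalgebra_natural_sigma)
  have "null_sets (restr_to_subalg P (natural_sigma P X s))
      \<subseteq> null_sets (restr_to_subalg P (natural_sigma P X t))"
    using sets_natural_sigma_mono[OF assms(1)] by (auto simp: null_sets_restr_to_subalg sub)
  then show ?thesis
    using sets_natural_sigma_mono[OF assms(1)]
    unfolding filt_def sets_completion sets_restr_to_subalg[OF sub(1)] sets_restr_to_subalg[OF sub(2)]
    by blast
qed

lemma subalgebra_filt: "t \<le> T \<Longrightarrow> subalgebra P (filt P X t)"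
  unfolding subalgebra_def space_filt using sets_filt_mono[of t T] sets_P by auto

lemma subalgebra_filt_filt: "s \<le> t \<Longrightarrow> t \<le> T \<Longrightarrow> subalgebra (filt P X t) (filt P X s)"
  unfolding subalgebra_def space_filt using sets_filt_mono by auto

text \<open>Only the sets of \<open>P\<close> are given as those of a completion, so a
  \<open>P\<close>-null set must be covered by a null set of the uncompleted sigma-algebra. In its
  decomposition into \<open>S\<close> and \<open>M\<close>, the measurable part \<open>S\<close> is
  null because it lies inside the given null set, and \<open>M\<close> has a null cover by
  definition.\<close>

lemma complete_P: "complete_measure P"
proof
  fix A N assume AN: "A \<subseteq> N" "N \<in> null_sets P"
  let ?R = "restr_to_subalg P (natural_sigma P X T)"
  have sub: "subalgebra P (natural_sigma P X T)" by (simp add: subalgebra_natural_sigma)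
  from AN have "N \<in> sets (completion ?R)"
    using sets_P by (auto simp: filt_def)
  then obtain S M M' where *: "N = S \<union> M" "S \<in> sets ?R" "M' \<in> null_sets ?R" "M \<subseteq> M'"
    unfolding sets_completion by blast
  have "S \<in> sets P" using *(2) sub by (auto simp: sets_restr_to_subalg subalgebra_def)
  then have "S \<in> null_sets P" using *(1) AN(2)
    by (metis null_sets_subset Un_upper1)
  then have "S \<in> null_sets ?R" using *(2) sub by (simp add: null_sets_restr_to_subalg sets_restr_to_subalg)
  with * have "S \<union> M' \<in> null_sets ?R" "A \<subseteq> S \<union> M'" using AN(1) by auto
  then have "A \<in> sets (completion ?R)"
    unfolding sets_completion by blast
  then show "A \<in> sets P" using sets_P by (simp add: filt_def)
qed

section \<open>Histories as the atoms of the filtration\<close>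

lemma finite_histories: "t \<le> T \<Longrightarrow> finite (history t ` space P)"
proof (rule finite_subset)
  assume t: "t \<le> T"
  let ?B = "range (\<lambda>i::'m. axis i (1::real))"
  show "history t ` space P \<subseteq> {f. \<forall>s. (s \<in> {..t} \<longrightarrow> f s \<in> ?B) \<and> (s \<notin> {..t} \<longrightarrow> f s = 0)}"
  proof (intro image_subsetI CollectI allI conjI impI)
    fix \<omega> s assume "\<omega> \<in> space P" "s \<in> {..t}"
    then show "history t \<omega> s \<in> ?B" using X_basis[of s \<omega>] t by (auto simp: history_def)
  qed (simp add: history_def)
  show "finite {f. \<forall>s. (s \<in> {..t} \<longrightarrow> f s \<in> ?B) \<and> (s \<notin> {..t} \<longrightarrow> f s = (0::real^'m))}"
    by (rule finite_set_of_finite_funs) auto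
qed

lemma history_event_natural:
  assumes "t \<le> T"
  shows "{\<omega>\<in>space P. history t \<omega> = y} \<in> sets (natural_sigma P X t)"
proof (cases "\<forall>s>t. y s = 0")
  case True
  then have eq: "{\<omega>\<in>space P. history t \<omega> = y} = {\<omega>\<in>space (natural_sigma P X t). \<forall>s\<in>{..t}. \<omega> \<in> X s -` {y s} \<inter> space P}"
    by (auto simp: history_def space_natural_sigma fun_eq_iff)
  have "X s -` {y s} \<inter> space P \<in> sets (natural_sigma P X t)" if "s \<le> t" for s
    unfolding sets_natural_sigma
    by (rule sigma_sets.Basic) (use that in \<open>auto intro!: bexI[of _ s] exI[of _ "{y s}"]\<close>)
  then show ?thesis unfolding eq
    by (intro sets.sets_Collect_finite_All') (auto simp: Int_def vimage_def space_natural_sigma conj_commute)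
next
  case False
  then have "{\<omega>\<in>space P. history t \<omega> = y} = {}" by (force simp: history_def)
  then show ?thesis by (simp only: sets.empty_sets)
qed

text \<open>The history has finite range and measurable fibres, so it is measurable into a discrete
  space and may be followed by an arbitrary function. This is why \<open>adapted\<close> can be
  stated without any measurability of \<open>\<gamma>\<close>.\<close>

lemma history_measurable_natural:
  assumes "t \<le> T"
  shows "(\<lambda>\<omega>. \<gamma> (history t \<omega>)) \<in> measurable (natural_sigma P X t) (borel :: 'c::topological_space measure)"
proof -
  have "history t \<in> measurable (natural_sigma P X t) (count_space (history t ` space P))"
    using history_event_natural[OF assms]
    by (subst measurable_count_space_eq2[OF finite_histories[OF assms]])
       (auto simp: space_natural_sigma vimage_def Int_def conj_commute)
  then show ?thesis
    by (rule measurable_compose) auto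
qed

lemma history_measurable_filt:
  "t \<le> T \<Longrightarrow> (\<lambda>\<omega>. \<gamma> (history t \<omega>)) \<in> measurable (filt P X t) (borel :: 'c::topological_space measure)"
  by (rule measurable_from_subalg[OF _ history_measurable_natural])
     (auto simp: subalgebra_def space_filt space_natural_sigma natural_sigma_subset_filt)

lemma history_measurable:
  "t \<le> T \<Longrightarrow> (\<lambda>\<omega>. \<gamma> (history t \<omega>)) \<in> measurable P (borel :: 'c::topological_space measure)"
  by (rule measurable_from_subalg[OF subalgebra_filt history_measurable_filt])

lemma history_event: "t \<le> T \<Longrightarrow> {\<omega>\<in>space P. history t \<omega> = y} \<in> sets (filt P X t)"
  using history_event_natural natural_sigma_subset_filt by blast

lemma history_event_P: "t \<le> T \<Longrightarrow> {\<omega>\<in>space P. history t \<omega> = y} \<in> sets P"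
  using history_event subalgebra_filt unfolding subalgebra_def by blast

lemma natural_sigma_sets_history:
  assumes "A \<in> sets (natural_sigma P X t)"
    "\<omega> \<in> space P" "\<omega>' \<in> space P" "history t \<omega> = history t \<omega>'"
  shows "\<omega> \<in> A \<longleftrightarrow> \<omega>' \<in> A"
  using assms(1) unfolding sets_natural_sigma
proof induction
  case (Basic a)
  then obtain s B where "s \<le> t" "a = X s -` B \<inter> space P" by auto
  moreover have "X s \<omega> = X s \<omega>'" if "s \<le> t" for s
    using fun_cong[OF assms(4), of s] that by (simp add: history_def)
  ultimately show ?case using assms by simp
qed (use assms in auto)

text \<open>A Doob-Dynkin factorisation. After passing to a version \<open>g'\<close> measurable for
  the uncompleted sigma-algebra, each level set of \<open>g'\<close> is a union of fibres of the
  history; so \<open>g'\<close> is determined by its values at the representatives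
  \<open>r y\<close>, one for each history.\<close>

lemma adapted_filt_real:
  fixes g :: "'a \<Rightarrow> real"
  assumes "g \<in> borel_measurable (filt P X t)" "t \<le> T"
  shows "adapted t g"
proof -
  let ?R = "restr_to_subalg P (natural_sigma P X t)"
  have sub: "subalgebra P (natural_sigma P X t)" by (simp add: subalgebra_natural_sigma assms)
  obtain g' where g': "g' \<in> borel_measurable ?R" "AE x in ?R. g x = g' x"
    using completion_ex_borel_measurable_real assms(1) unfolding filt_def by blast
  define r where "r y = (SOME \<omega>. \<omega> \<in> space P \<and> history t \<omega> = y)" for y
  have "g' \<omega> = g' (r (history t \<omega>))" if "\<omega> \<in> space P" for \<omega>
  proof -
    have r: "r (history t \<omega>) \<in> space P \<and> history t (r (history t \<omega>)) = history t \<omega>"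
      unfolding r_def by (rule someI[of _ \<omega>]) (use that in auto)
    have "g' -` {g' \<omega>} \<inter> space P \<in> sets (natural_sigma P X t)"
      using measurable_sets[OF g'(1), of "{g' \<omega>}"]
      by (simp add: sets_restr_to_subalg[OF sub] space_restr_to_subalg)
    from natural_sigma_sets_history[OF this that, of "r (history t \<omega>)"] r that
    show ?thesis by auto
  qed
  moreover have "AE x in P. g x = g' x" by (rule AE_restr_to_subalg[OF sub g'(2)])
  ultimately have "AE \<omega> in P. g \<omega> = (\<lambda>y. g' (r y)) (history t \<omega>)"
    by (auto elim!: AE_mp intro!: AE_I2)
  then show ?thesis unfolding adapted_def by (intro exI[of _ "\<lambda>y. g' (r y)"]) simp
qed

section \<open>Closure properties of adaptedness, boundedness, charged histories\<close>

lemma adapted_comp: "adapted t g \<Longrightarrow> adapted t (\<lambda>\<omega>. h (g \<omega>))"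
  unfolding adapted_def by (elim exE, rule_tac x="\<lambda>y. h (\<gamma> y)" in exI) auto

lemma adapted_comp2:
  assumes "adapted t f" "adapted t g" shows "adapted t (\<lambda>\<omega>. h (f \<omega>) (g \<omega>))"
proof -
  obtain a b where ab: "AE \<omega> in P. f \<omega> = a (history t \<omega>)" "AE \<omega> in P. g \<omega> = b (history t \<omega>)"
    using assms by (auto simp: adapted_def)
  have "AE \<omega> in P. h (f \<omega>) (g \<omega>) = h (a (history t \<omega>)) (b (history t \<omega>))"
    using ab by auto
  then show ?thesis unfolding adapted_def by (rule exI[of _ "\<lambda>y. h (a y) (b y)"])
qed

lemma adapted_history: "adapted t (history t)"
  unfolding adapted_def by (rule exI[of _ id]) simp

lemma adapted_const: "adapted t (\<lambda>_. c)"
  unfolding adapted_def by (rule exI[of _ "\<lambda>_. c"]) simp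

lemma history_restrict: "s \<le> t \<Longrightarrow> history s \<omega> = (\<lambda>r. if r \<le> s then history t \<omega> r else 0)"
  by (auto simp: history_def fun_eq_iff)

lemma adapted_mono:
  assumes "adapted s g" "s \<le> t" shows "adapted t g"
proof -
  have "adapted t (history s)"
    using adapted_comp[OF adapted_history, of t "\<lambda>p r. if r \<le> s then p r else 0"]
    by (subst history_restrict[OF assms(2), abs_def])
  then show ?thesis using assms(1)
    unfolding adapted_def
    by (elim exE, rename_tac a b, rule_tac x="\<lambda>y. b (a y)" in exI) auto
qed

lemma adapted_X: "s \<le> t \<Longrightarrow> adapted t (X s)"
  using adapted_comp[OF adapted_history, of t "\<lambda>p. p s"] by (simp add: history_def)

lemma adapted_Pi:
  assumes "\<And>i::'i::finite. adapted t (g i)"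
  shows "adapted t (\<lambda>\<omega> i. g i \<omega>)"
proof -
  obtain c where c: "\<And>i. AE \<omega> in P. g i \<omega> = c i (history t \<omega>)"
    using assms unfolding adapted_def by metis
  have "AE \<omega> in P. \<forall>i\<in>UNIV. g i \<omega> = c i (history t \<omega>)"
    using c by (intro AE_finite_allI) auto
  then have "AE \<omega> in P. (\<lambda>i. g i \<omega>) = (\<lambda>i. c i (history t \<omega>))"
    by eventually_elim auto
  then show ?thesis unfolding adapted_def by (rule exI[of _ "\<lambda>y i. c i y"])
qed

lemma adapted_vec:
  assumes "\<And>i. adapted t (\<lambda>\<omega>. g \<omega> $ i)"
  shows "adapted t g"
  using adapted_comp[OF adapted_Pi[of t "\<lambda>i \<omega>. g \<omega> $ i", OF assms], of "\<lambda>h. \<chi> i. h i"]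
  by simp

text \<open>Bundling the family into one function-valued variable makes any finite operation on it,
  such as a sum, a product or an evaluation at a random index, a single composition.\<close>

lemma adapted_finite:
  assumes "finite I" "\<And>i. i \<in> I \<Longrightarrow> adapted t (g i)"
  shows "adapted t (\<lambda>\<omega>. restrict (\<lambda>i. g i \<omega>) I)"
proof -
  obtain c where c: "\<And>i. i \<in> I \<Longrightarrow> AE \<omega> in P. g i \<omega> = c i (history t \<omega>)"
    using assms(2) unfolding adapted_def by metis
  have "AE \<omega> in P. \<forall>i\<in>I. g i \<omega> = c i (history t \<omega>)"
    using c assms(1) by (intro AE_finite_allI) auto
  then have "AE \<omega> in P. restrict (\<lambda>i. g i \<omega>) I = restrict (\<lambda>i. c i (history t \<omega>)) I"
    by eventually_elim auto
  then show ?thesis unfolding adapted_def by (rule exI[of _ "\<lambda>y. restrict (\<lambda>i. c i y) I"])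
qed

lemma adapted_sum:
  assumes "finite I" "\<And>i. i \<in> I \<Longrightarrow> adapted t (g i)"
  shows "adapted t (\<lambda>\<omega>. \<Sum>i\<in>I. g i \<omega>)"
proof -
  have "adapted t (\<lambda>\<omega>. restrict (\<lambda>i. g i \<omega>) I)" using assms by (rule adapted_finite)
  from adapted_comp[OF this, of "\<lambda>h. \<Sum>i\<in>I. h i"] show ?thesis by simp
qed

lemma adapted_prod:
  assumes "finite I" "\<And>i. i \<in> I \<Longrightarrow> adapted t (g i)"
  shows "adapted t (\<lambda>\<omega>. \<Prod>i\<in>I. g i \<omega>)"
proof -
  have "adapted t (\<lambda>\<omega>. restrict (\<lambda>i. g i \<omega>) I)" using assms by (rule adapted_finite)
  from adapted_comp[OF this, of "\<lambda>h. \<Prod>i\<in>I. h i"] show ?thesis by simp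
qed

lemma adapted_filt_vec:
  fixes g :: "'a \<Rightarrow> real^'k"
  assumes "g \<in> borel_measurable (filt P X t)" "t \<le> T"
  shows "adapted t g"
  by (rule adapted_vec, rule adapted_filt_real)
     (auto intro!: measurable_compose[OF assms(1)] assms(2) borel_measurable_continuous_onI continuous_intros)

lemma adapted_P_real: "(g :: 'a \<Rightarrow> real) \<in> borel_measurable P \<Longrightarrow> adapted T g"
  by (rule adapted_filt_real) (auto simp: measurable_cong_sets[OF sets_P refl])

lemma measurable_P_AE:
  fixes g :: "'a \<Rightarrow> 'c::topological_space"
  assumes g: "g \<in> borel_measurable P" and ae: "AE \<omega> in P. f \<omega> = g \<omega>"
  shows "f \<in> borel_measurable P"
proof (rule measurableI)
  fix A :: "'c set" assume A: "A \<in> sets borel"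
  interpret complete_measure P by (rule complete_P)
  show "f -` A \<inter> space P \<in> sets P"
    by (rule in_sets_AE[OF _ measurable_sets[OF g A]]) (use ae in auto)
qed simp

lemma adapted_measurable:
  fixes g :: "'a \<Rightarrow> 'c::topological_space"
  assumes "adapted t g" "t \<le> T" shows "g \<in> borel_measurable P"
  using assms history_measurable measurable_P_AE unfolding adapted_def by blast

lemma adapted_bounded:
  fixes g :: "'a \<Rightarrow> 'c::real_normed_vector"
  assumes "adapted t g" "t \<le> T"
  obtains c where "AE \<omega> in P. norm (g \<omega>) \<le> c"
proof -
  obtain \<gamma> where \<gamma>: "AE \<omega> in P. g \<omega> = \<gamma> (history t \<omega>)"
    using assms by (auto simp: adapted_def)
  have "AE \<omega> in P. norm (g \<omega>) \<le> Max ((\<lambda>y. norm (\<gamma> y)) ` history t ` space P)"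
    using \<gamma> AE_space
    by eventually_elim (auto intro!: Max_ge finite_imageI finite_histories assms)
  then show ?thesis using that by blast
qed

text \<open>The exceptional set is the same for every property \<open>R\<close>: the histories of
  probability zero. Uncountably many almost sure inequalities can therefore be used simultaneously,
  which the construction of essential infima requires.\<close>

lemma AE_history_iff:
  assumes "t \<le> T"
  shows "(AE \<omega> in P. R (history t \<omega>)) \<longleftrightarrow>
    (\<forall>y. measure P {\<omega>\<in>space P. history t \<omega> = y} > 0 \<longrightarrow> R y)"
proof
  assume L: "AE \<omega> in P. R (history t \<omega>)"
  show "\<forall>y. measure P {\<omega>\<in>space P. history t \<omega> = y} > 0 \<longrightarrow> R y"
  proof (intro allI impI, rule ccontr)
    fix y assume pos: "measure P {\<omega>\<in>space P. history t \<omega> = y} > 0" and "\<not> R y"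
    from L have "AE \<omega> in P. \<not> history t \<omega> = y"
      by eventually_elim (use \<open>\<not> R y\<close> in auto)
    then have "measure P {\<omega>\<in>space P. history t \<omega> = y} = 0"
      using history_event_P[OF assms] by (subst prob_Collect_eq_0) auto
    with pos show False by simp
  qed
next
  assume R: "\<forall>y. measure P {\<omega>\<in>space P. history t \<omega> = y} > 0 \<longrightarrow> R y"
  have "AE \<omega> in P. \<forall>y\<in>history t ` space P. history t \<omega> = y \<longrightarrow> R y"
  proof (rule AE_finite_allI[OF finite_histories[OF assms]])
    fix y assume "y \<in> history t ` space P"
    show "AE \<omega> in P. history t \<omega> = y \<longrightarrow> R y"
    proof (cases "R y")
      case False
      then have "measure P {\<omega>\<in>space P. history t \<omega> = y} = 0"
        using R zero_less_measure_iff by blast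
      then have "AE \<omega> in P. \<not> history t \<omega> = y"
        using history_event_P[OF assms] by (subst (asm) prob_Collect_eq_0) auto
      then show ?thesis by eventually_elim auto
    qed auto
  qed
  then show "AE \<omega> in P. R (history t \<omega>)" using AE_space by eventually_elim auto
qed

end

section \<open>Conditional expectations under equivalent measures\<close>

context finite_state_process
begin

abbreviation cexp :: "'a measure \<Rightarrow> nat \<Rightarrow> ('a \<Rightarrow> real) \<Rightarrow> 'a \<Rightarrow> real" where
  "cexp Q t g \<equiv> real_cond_exp Q (filt P X t) g"

lemma equivalent_prob_self: "equivalent_prob P P"
  unfolding equivalent_prob_def absolutely_continuous_def by (auto intro: prob_space_axioms)

lemma AE_equivalent:
  assumes "equivalent_prob P Q"
  shows "(AE \<omega> in Q. R \<omega>) \<longleftrightarrow> (AE \<omega> in P. R \<omega>)"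
proof -
  have "null_sets Q = null_sets P" "space Q = space P"
    using assms sets_eq_imp_space_eq[of Q P]
    by (auto simp: equivalent_prob_def absolutely_continuous_def)
  then show ?thesis by (simp add: eventually_ae_filter)
qed

lemma subalgebra_equivalent:
  "equivalent_prob P Q \<Longrightarrow> t \<le> T \<Longrightarrow> subalgebra Q (filt P X t)"
  using subalgebra_filt[of t] sets_eq_imp_space_eq[of Q P]
  by (auto simp: equivalent_prob_def subalgebra_def)

lemma sigma_finite_subalgebra_equivalent:
  assumes "equivalent_prob P Q" "t \<le> T"
  shows "sigma_finite_subalgebra Q (filt P X t)"
proof -
  interpret Q: prob_space Q using assms by (simp add: equivalent_prob_def)
  show ?thesis
    by (rule finite_measure_subalgebra_is_sigma_finite)
       (unfold_locales, rule subalgebra_equivalent[OF assms])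
qed

lemma measurable_equivalent:
  "equivalent_prob P Q \<Longrightarrow> g \<in> borel_measurable Q \<longleftrightarrow> g \<in> borel_measurable P"
  by (auto simp: equivalent_prob_def cong: measurable_cong_sets)

lemma adapted_integrable:
  fixes g :: "'a \<Rightarrow> 'c::{banach, second_countable_topology}"
  assumes "equivalent_prob P Q" "adapted t g" "t \<le> T"
  shows "integrable Q g"
proof -
  interpret Q: prob_space Q using assms by (simp add: equivalent_prob_def)
  obtain c where "AE \<omega> in P. norm (g \<omega>) \<le> c" using adapted_bounded assms by blast
  then show ?thesis
    by (intro Q.integrable_const_bound[of _ c])
       (auto simp: AE_equivalent[OF assms(1)] measurable_equivalent[OF assms(1)]
         intro: adapted_measurable assms)
qed

lemma adapted_version:
  fixes g :: "'a \<Rightarrow> 'c::topological_space"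
  assumes "adapted t g" "t \<le> T"
  obtains g' where "g' \<in> borel_measurable (filt P X t)" "AE \<omega> in P. g \<omega> = g' \<omega>"
  using assms history_measurable_filt unfolding adapted_def by blast

lemma adapted_AE_cong:
  assumes "adapted t g" "AE \<omega> in P. h \<omega> = g \<omega>" shows "adapted t h"
proof -
  obtain c where "AE \<omega> in P. g \<omega> = c (history t \<omega>)" using assms(1) by (auto simp: adapted_def)
  with assms(2) have "AE \<omega> in P. h \<omega> = c (history t \<omega>)" by eventually_elim simp
  then show ?thesis unfolding adapted_def by (rule exI[of _ c])
qed

section \<open>Calculus of conditional expectations\<close>

lemma adapted_cexp: "t \<le> T \<Longrightarrow> adapted t (cexp Q t g)"
  by (rule adapted_filt_real) auto

lemma adapted_indicator: "A \<in> sets (filt P X t) \<Longrightarrow> t \<le> T \<Longrightarrow> adapted t (indicator A :: 'a \<Rightarrow> real)"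
  by (rule adapted_filt_real) auto

lemma adapted_add: "adapted t f \<Longrightarrow> adapted t g \<Longrightarrow> adapted t (\<lambda>\<omega>. f \<omega> + g \<omega> :: 'c::plus)"
  by (rule adapted_comp2)

lemma adapted_diff: "adapted t f \<Longrightarrow> adapted t g \<Longrightarrow> adapted t (\<lambda>\<omega>. f \<omega> - g \<omega> :: 'c::minus)"
  by (rule adapted_comp2)

lemma adapted_mult: "adapted t f \<Longrightarrow> adapted t g \<Longrightarrow> adapted t (\<lambda>\<omega>. f \<omega> * g \<omega> :: 'c::times)"
  by (rule adapted_comp2)

text \<open>Since \<open>h\<close> equals an F_t-measurable function only almost surely, the
  averaging property is applied to a version \<open>h'\<close>. Null sets are those of
  \<open>P\<close> because \<open>Q\<close> is equivalent to it. The next lemma follows the same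
  pattern.\<close>

lemma cexp_integral:
  assumes "equivalent_prob P Q" "t \<le> T" "adapted t h" "adapted T g"
  shows "(\<integral>\<omega>. h \<omega> * cexp Q t g \<omega> \<partial>Q) = (\<integral>\<omega>. h \<omega> * g \<omega> \<partial>Q)"
proof -
  interpret sigma_finite_subalgebra Q "filt P X t"
    by (rule sigma_finite_subalgebra_equivalent[OF assms(1,2)])
  obtain h' where h': "h' \<in> borel_measurable (filt P X t)" "AE \<omega> in P. h \<omega> = h' \<omega>"
    using adapted_version assms by blast
  have h'Q: "AE \<omega> in Q. h \<omega> = h' \<omega>" using h'(2) by (simp add: AE_equivalent[OF assms(1)])
  have ad: "adapted T h'" by (rule adapted_mono[OF adapted_filt_real[OF h'(1)]]) (use assms in auto)
  have adh: "adapted T h" by (rule adapted_mono[OF assms(3,2)])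
  have meas: "g \<in> borel_measurable Q" "h \<in> borel_measurable Q" "h' \<in> borel_measurable Q"
    using adapted_measurable[OF _ order_refl] assms(4) ad adh
    by (auto simp: measurable_equivalent[OF assms(1)])
  have [measurable]: "cexp Q t g \<in> borel_measurable Q" by simp
  have "(\<integral>\<omega>. h \<omega> * cexp Q t g \<omega> \<partial>Q) = (\<integral>\<omega>. h' \<omega> * cexp Q t g \<omega> \<partial>Q)"
    by (rule integral_cong_AE) (use meas h'Q in auto)
  also have "\<dots> = (\<integral>\<omega>. h' \<omega> * g \<omega> \<partial>Q)"
    by (rule real_cond_exp_intg[OF adapted_integrable[OF assms(1) adapted_mult[OF ad assms(4)] order_refl] h'(1) meas(1)])
  also have "\<dots> = (\<integral>\<omega>. h \<omega> * g \<omega> \<partial>Q)"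
    by (rule integral_cong_AE) (use meas h'Q in auto)
  finally show ?thesis .
qed

lemma cexp_charact:
  assumes "equivalent_prob P Q" "t \<le> T" "adapted t h" "adapted T g"
    and eq: "\<And>A. A \<in> sets (filt P X t) \<Longrightarrow> (\<integral>\<omega>. indicator A \<omega> * g \<omega> \<partial>Q) = (\<integral>\<omega>. indicator A \<omega> * h \<omega> \<partial>Q)"
  shows "AE \<omega> in P. cexp Q t g \<omega> = h \<omega>"
proof -
  interpret sigma_finite_subalgebra Q "filt P X t"
    by (rule sigma_finite_subalgebra_equivalent[OF assms(1,2)])
  obtain h' where h': "h' \<in> borel_measurable (filt P X t)" "AE \<omega> in P. h \<omega> = h' \<omega>"
    using adapted_version assms by blast
  have h'Q: "AE \<omega> in Q. h \<omega> = h' \<omega>" using h'(2) by (simp add: AE_equivalent[OF assms(1)])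
  have ad: "adapted T h'" by (rule adapted_mono[OF adapted_filt_real[OF h'(1)]]) (use assms in auto)
  have adh: "adapted T h" by (rule adapted_mono[OF assms(3,2)])
  have meas: "h \<in> borel_measurable Q" "h' \<in> borel_measurable Q"
    using adapted_measurable[OF _ order_refl] ad adh
    by (auto simp: measurable_equivalent[OF assms(1)])
  have "AE \<omega> in Q. cexp Q t g \<omega> = h' \<omega>"
  proof (rule real_cond_exp_charact)
    fix A assume A: "A \<in> sets (filt P X t)"
    then have AQ: "A \<in> sets Q" using subalg by (auto simp: subalgebra_def)
    have "(\<integral>\<omega>. indicator A \<omega> * h \<omega> \<partial>Q) = (\<integral>\<omega>. indicator A \<omega> * h' \<omega> \<partial>Q)"
      by (rule integral_cong_AE) (use meas h'Q AQ in auto)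
    with eq[OF A] show "(\<integral>\<omega>\<in>A. g \<omega> \<partial>Q) = (\<integral>\<omega>\<in>A. h' \<omega> \<partial>Q)"
      by (simp add: set_lebesgue_integral_def)
  qed (use adapted_integrable assms ad h' in auto)
  then show ?thesis using h'(2) unfolding AE_equivalent[OF assms(1)] by eventually_elim simp
qed

lemma cexp_mult:
  assumes "equivalent_prob P Q" "t \<le> T" "adapted t h" "adapted T g"
  shows "AE \<omega> in P. cexp Q t (\<lambda>\<omega>. h \<omega> * g \<omega>) \<omega> = h \<omega> * cexp Q t g \<omega>"
proof (rule cexp_charact[OF assms(1,2)])
  fix A assume "A \<in> sets (filt P X t)"
  then have "adapted t (\<lambda>\<omega>. indicator A \<omega> * h \<omega>)"
    by (intro adapted_mult adapted_indicator assms)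
  from cexp_integral[OF assms(1,2) this assms(4)]
  show "(\<integral>\<omega>. indicator A \<omega> * (h \<omega> * g \<omega>) \<partial>Q) = (\<integral>\<omega>. indicator A \<omega> * (h \<omega> * cexp Q t g \<omega>) \<partial>Q)"
    by (simp add: mult.assoc)
qed (intro adapted_mult adapted_cexp assms adapted_mono[OF assms(3)])+

lemma cexp_adapted:
  assumes "equivalent_prob P Q" "t \<le> T" "adapted t h"
  shows "AE \<omega> in P. cexp Q t h \<omega> = h \<omega>"
  by (rule cexp_charact[OF assms]) (auto intro: adapted_mono assms)

lemma cexp_cong:
  assumes "equivalent_prob P Q" "t \<le> T" "adapted T g" "AE \<omega> in P. f \<omega> = g \<omega>"
  shows "AE \<omega> in P. cexp Q t f \<omega> = cexp Q t g \<omega>"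
proof -
  interpret sigma_finite_subalgebra Q "filt P X t"
    by (rule sigma_finite_subalgebra_equivalent[OF assms(1,2)])
  have "adapted T f" by (rule adapted_AE_cong[OF assms(3,4)])
  then have "AE \<omega> in Q. cexp Q t f \<omega> = cexp Q t g \<omega>"
    using assms(3,4) adapted_measurable
    by (intro real_cond_exp_cong) (auto simp: AE_equivalent[OF assms(1)] measurable_equivalent[OF assms(1)])
  then show ?thesis by (simp add: AE_equivalent[OF assms(1)])
qed

lemma cexp_add:
  assumes "equivalent_prob P Q" "t \<le> T" "adapted T f" "adapted T g"
  shows "AE \<omega> in P. cexp Q t (\<lambda>\<omega>. f \<omega> + g \<omega>) \<omega> = cexp Q t f \<omega> + cexp Q t g \<omega>"
  using sigma_finite_subalgebra.real_cond_exp_add[OF sigma_finite_subalgebra_equivalent[OF assms(1,2)]]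
    adapted_integrable[OF assms(1) assms(3) order_refl] adapted_integrable[OF assms(1) assms(4) order_refl]
  by (simp add: AE_equivalent[OF assms(1)])

lemma cexp_diff:
  assumes "equivalent_prob P Q" "t \<le> T" "adapted T f" "adapted T g"
  shows "AE \<omega> in P. cexp Q t (\<lambda>\<omega>. f \<omega> - g \<omega>) \<omega> = cexp Q t f \<omega> - cexp Q t g \<omega>"
  using sigma_finite_subalgebra.real_cond_exp_diff[OF sigma_finite_subalgebra_equivalent[OF assms(1,2)]]
    adapted_integrable[OF assms(1) assms(3) order_refl] adapted_integrable[OF assms(1) assms(4) order_refl]
  by (simp add: AE_equivalent[OF assms(1)])

lemma cexp_sum:
  assumes "equivalent_prob P Q" "t \<le> T" "\<And>i. adapted T (g i)"
  shows "AE \<omega> in P. cexp Q t (\<lambda>\<omega>. \<Sum>i\<in>I. g i \<omega>) \<omega> = (\<Sum>i\<in>I. cexp Q t (g i) \<omega>)"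
  unfolding AE_equivalent[OF assms(1), symmetric]
  by (rule sigma_finite_subalgebra.real_cond_exp_sum[OF sigma_finite_subalgebra_equivalent[OF assms(1,2)]])
     (rule adapted_integrable[OF assms(1) assms(3) order_refl])

lemma cexp_mono:
  assumes "equivalent_prob P Q" "t \<le> T" "adapted T f" "adapted T g" "AE \<omega> in P. f \<omega> \<le> g \<omega>"
  shows "AE \<omega> in P. cexp Q t f \<omega> \<le> cexp Q t g \<omega>"
  using sigma_finite_subalgebra.real_cond_exp_mono[OF sigma_finite_subalgebra_equivalent[OF assms(1,2)]]
    adapted_integrable[OF assms(1) assms(3) order_refl] adapted_integrable[OF assms(1) assms(4) order_refl] assms(5)
  by (simp add: AE_equivalent[OF assms(1)])

lemma cexp_tower:
  assumes "equivalent_prob P Q" "s \<le> t" "t \<le> T" "adapted T g"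
  shows "AE \<omega> in P. cexp Q s (cexp Q t g) \<omega> = cexp Q s g \<omega>"
  using sigma_finite_subalgebra.real_cond_exp_nested_subalg[OF
      sigma_finite_subalgebra_equivalent[OF assms(1), of s] subalgebra_equivalent[OF assms(1,3)]
      subalgebra_filt_filt[OF assms(2,3)] adapted_integrable[OF assms(1,4)]] assms(2,3)
  by (simp add: AE_equivalent[OF assms(1)])

lemma cexp_linear_comb:
  assumes "equivalent_prob P Q" "t \<le> T" "\<And>i. adapted t (h i)" "\<And>i. adapted T (g i)"
    "finite I"
  shows "AE \<omega> in P. cexp Q t (\<lambda>\<omega>. \<Sum>i\<in>I. h i \<omega> * g i \<omega>) \<omega> = (\<Sum>i\<in>I. h i \<omega> * cexp Q t (g i) \<omega>)"
proof -
  have "AE \<omega> in P. cexp Q t (\<lambda>\<omega>. \<Sum>i\<in>I. h i \<omega> * g i \<omega>) \<omega> = (\<Sum>i\<in>I. cexp Q t (\<lambda>\<omega>. h i \<omega> * g i \<omega>) \<omega>)"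
    by (intro cexp_sum assms adapted_mult adapted_mono[OF assms(3)])
  moreover have "AE \<omega> in P. \<forall>i\<in>I. cexp Q t (\<lambda>\<omega>. h i \<omega> * g i \<omega>) \<omega> = h i \<omega> * cexp Q t (g i) \<omega>"
    using assms by (intro AE_finite_allI cexp_mult)
  ultimately show ?thesis by eventually_elim simp
qed

end

section \<open>The driving martingale\<close>

context finite_state_process
begin

abbreviation jump_prob :: "nat \<Rightarrow> 'a \<Rightarrow> 'm \<Rightarrow> real" where
  "jump_prob t \<omega> i \<equiv> cexp P t (\<lambda>\<omega>. X (Suc t) \<omega> $ i) \<omega>"

section \<open>Conditional jump probabilities and covariance\<close>

lemma X_nth:
  assumes "t \<le> T" "\<omega> \<in> space P"
  shows "X t \<omega> $ i * X t \<omega> $ j = (if i = j then X t \<omega> $ i else 0)"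
    and "(\<Sum>i\<in>UNIV. X t \<omega> $ i) = 1" and "X t \<omega> $ i \<ge> 0"
    and "X t \<omega> = axis i 1 \<longleftrightarrow> X t \<omega> $ i = 1" and "X t \<omega> $ i = 0 \<or> X t \<omega> $ i = 1"
proof -
  obtain k where "X t \<omega> = axis k 1" using X_basis assms by blast
  then show "X t \<omega> $ i * X t \<omega> $ j = (if i = j then X t \<omega> $ i else 0)"
    "(\<Sum>i\<in>UNIV. X t \<omega> $ i) = 1" "X t \<omega> $ i \<ge> 0"
    "X t \<omega> = axis i 1 \<longleftrightarrow> X t \<omega> $ i = 1" "X t \<omega> $ i = 0 \<or> X t \<omega> $ i = 1"
    by (auto simp: axis_def vec_eq_iff)
qed

lemma adapted_X_nth: "s \<le> t \<Longrightarrow> adapted t (\<lambda>\<omega>. X s \<omega> $ i)"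
  using adapted_comp[OF adapted_X, of s t "\<lambda>x. x $ i"] .

lemma M_diff_nth: "M_diff P X (Suc t) \<omega> $ i = X (Suc t) \<omega> $ i - jump_prob t \<omega> i"
  by (simp add: M_diff_def vec_cond_exp_def)

lemma adapted_M_diff:
  assumes "t < T" shows "adapted (Suc t) (M_diff P X (Suc t))"
  by (rule adapted_vec, unfold M_diff_nth)
     (intro adapted_diff adapted_X_nth adapted_mono[OF adapted_cexp], use assms in auto)

lemma adapted_M_diff_nth:
  "t < T \<Longrightarrow> Suc t \<le> s \<Longrightarrow> adapted s (\<lambda>\<omega>. M_diff P X (Suc t) \<omega> $ i)"
  by (rule adapted_mono[OF adapted_comp[OF adapted_M_diff]])

lemma jump_prob_distribution:
  assumes "t < T"
  shows "AE \<omega> in P. (\<forall>i. jump_prob t \<omega> i \<ge> 0) \<and> (\<Sum>i\<in>UNIV. jump_prob t \<omega> i) = 1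
     \<and> (\<forall>i. jump_prob t \<omega> i = 0 \<longrightarrow> X (Suc t) \<omega> $ i = 0)"
proof -
  have t: "t \<le> T" "Suc t \<le> T" using assms by auto
  interpret sigma_finite_subalgebra P "filt P X t"
    by (rule sigma_finite_subalgebra_equivalent[OF equivalent_prob_self t(1)])
  have mX: "(\<lambda>\<omega>. X (Suc t) \<omega> $ i) \<in> borel_measurable P" for i
    by (rule adapted_measurable[OF adapted_X_nth[OF order_refl] t(2)])
  have "AE \<omega> in P. \<forall>i\<in>UNIV. jump_prob t \<omega> i \<ge> 0"
    by (intro AE_finite_allI real_cond_exp_pos mX AE_I2 X_nth t) auto
  moreover have "AE \<omega> in P. (\<Sum>i\<in>UNIV. jump_prob t \<omega> i) = 1"
  proof -
    have "AE \<omega> in P. cexp P t (\<lambda>\<omega>. \<Sum>i\<in>UNIV. X (Suc t) \<omega> $ i) \<omega> = cexp P t (\<lambda>_. 1) \<omega>"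
      by (rule cexp_cong[OF equivalent_prob_self t(1) adapted_const]) (auto simp: X_nth t)
    moreover have "AE \<omega> in P. cexp P t (\<lambda>_. 1) \<omega> = 1"
      by (rule cexp_adapted[OF equivalent_prob_self t(1) adapted_const])
    moreover have "AE \<omega> in P. cexp P t (\<lambda>\<omega>. \<Sum>i\<in>UNIV. X (Suc t) \<omega> $ i) \<omega> = (\<Sum>i\<in>UNIV. jump_prob t \<omega> i)"
      by (rule cexp_sum[OF equivalent_prob_self t(1) adapted_X_nth[OF t(2)]])
    ultimately show ?thesis by eventually_elim simp
  qed
  moreover have "AE \<omega> in P. \<forall>i\<in>UNIV. jump_prob t \<omega> i = 0 \<longrightarrow> X (Suc t) \<omega> $ i = 0"
  proof (intro AE_finite_allI)
    fix i
    \<comment> \<open>Testing against the indicator of the event that the conditional probability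
      vanishes: the nonnegative variable \<open>?h\<close> times the coordinate of the next state
      has mean zero, hence is zero almost surely.\<close>
    let ?h = "\<lambda>\<omega>. if jump_prob t \<omega> i = 0 then 1 else 0 :: real"
    have h: "adapted t ?h" using adapted_comp[OF adapted_cexp[OF t(1)]] .
    have a: "adapted T (\<lambda>\<omega>. ?h \<omega> * X (Suc t) \<omega> $ i)"
      by (intro adapted_mult adapted_mono[OF h] adapted_X_nth t)
    have "(\<integral>\<omega>. ?h \<omega> * X (Suc t) \<omega> $ i \<partial>P) = (\<integral>\<omega>. ?h \<omega> * jump_prob t \<omega> i \<partial>P)"
      by (rule cexp_integral[symmetric, OF equivalent_prob_self t(1) h adapted_X_nth[OF t(2)]])
    also have "\<dots> = 0" by (rule integral_eq_zero_AE) auto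
    finally have "AE \<omega> in P. ?h \<omega> * X (Suc t) \<omega> $ i = 0"
      using X_nth(3)[OF t(2)]
      by (subst (asm) integral_nonneg_eq_0_iff_AE)
         (auto intro: adapted_integrable[OF equivalent_prob_self a order_refl])
    then show "AE \<omega> in P. jump_prob t \<omega> i = 0 \<longrightarrow> X (Suc t) \<omega> $ i = 0"
      by eventually_elim auto
  qed simp
  ultimately show ?thesis by eventually_elim auto
qed

lemma cexp_M_diff:
  assumes "t < T"
  shows "AE \<omega> in P. cexp P t (\<lambda>\<omega>. M_diff P X (Suc t) \<omega> $ i) \<omega> = 0"
proof -
  have t: "t \<le> T" "Suc t \<le> T" using assms by auto
  have a: "adapted t (\<lambda>\<omega>. jump_prob t \<omega> i)" by (rule adapted_cexp[OF t(1)])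
  have "AE \<omega> in P. cexp P t (\<lambda>\<omega>. M_diff P X (Suc t) \<omega> $ i) \<omega>
      = jump_prob t \<omega> i - cexp P t (\<lambda>\<omega>. jump_prob t \<omega> i) \<omega>"
    unfolding M_diff_nth
    by (rule cexp_diff[OF equivalent_prob_self t(1) adapted_X_nth[OF t(2)] adapted_mono[OF a t(1)]])
  with cexp_adapted[OF equivalent_prob_self t(1) a] show ?thesis by eventually_elim simp
qed

lemma possible_jumps_iff:
  assumes "t < T"
  shows "AE \<omega> in P. \<forall>i. i \<in> possible_jumps P X t \<omega> \<longleftrightarrow> jump_prob t \<omega> i \<noteq> 0"
proof -
  have t: "t \<le> T" "Suc t \<le> T" using assms by auto
  have "AE \<omega> in P. \<forall>i\<in>UNIV. cexp P t (indicator {\<omega> \<in> space P. X (Suc t) \<omega> = axis i 1}) \<omega> = jump_prob t \<omega> i"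
  proof (intro AE_finite_allI cexp_cong equivalent_prob_self t(1) adapted_X_nth[OF t(2)] AE_I2)
    fix i \<omega> assume \<omega>: "\<omega> \<in> space P"
    show "indicator {\<omega> \<in> space P. X (Suc t) \<omega> = axis i 1} \<omega> = X (Suc t) \<omega> $ i"
      using X_nth(4,5)[OF t(2) \<omega>, of i] \<omega> by (auto simp: indicator_def)
  qed simp
  with jump_prob_distribution[OF assms] show ?thesis
    by eventually_elim (auto simp: possible_jumps_def less_le)
qed

lemma psi_eq:
  assumes "t < T"
  shows "AE \<omega> in P. psi P X t \<omega> =
    (\<chi> i j. (if i = j then jump_prob t \<omega> i else 0) - jump_prob t \<omega> i * jump_prob t \<omega> j)"
proof -
  have t: "t \<le> T" "Suc t \<le> T" using assms by auto
  let ?M = "\<lambda>i \<omega>. M_diff P X (Suc t) \<omega> $ i"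
  let ?X = "\<lambda>i \<omega>. X (Suc t) \<omega> $ i"
  have p: "adapted t (\<lambda>\<omega>. jump_prob t \<omega> i)" for i by (rule adapted_cexp[OF t(1)])
  note adT = adapted_X_nth[OF t(2)] adapted_M_diff_nth[OF assms t(2)]
  note E = equivalent_prob_self t(1)
  have "AE \<omega> in P. cexp P t (\<lambda>\<omega>. ?M i \<omega> * ?M j \<omega>) \<omega>
      = (if i = j then jump_prob t \<omega> i else 0) - jump_prob t \<omega> i * jump_prob t \<omega> j" for i j
  proof -
    let ?d = "if i = j then 1 else 0 :: real"
    \<comment> \<open>The basis property turns the product of two coordinates of the next state into
      a single coordinate. Every term is then an F_t-coefficient times one coordinate of the state
      or of the increment, and the last term has conditional mean zero.\<close>
    have eq: "?M i \<omega> * ?M j \<omega> = (?d * ?X i \<omega> - jump_prob t \<omega> j * ?X i \<omega>) - jump_prob t \<omega> i * ?M j \<omega>"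
      if "\<omega> \<in> space P" for \<omega>
      using X_nth(1)[OF t(2) that, of i j] by (simp add: M_diff_nth algebra_simps)
    have a: "adapted T (\<lambda>\<omega>. ?d * ?X i \<omega>)" "adapted T (\<lambda>\<omega>. jump_prob t \<omega> j * ?X i \<omega>)"
      "adapted T (\<lambda>\<omega>. jump_prob t \<omega> i * ?M j \<omega>)"
      by (intro adapted_mult adapted_const adT adapted_mono[OF p t(1)])+
    have "AE \<omega> in P. cexp P t (\<lambda>\<omega>. ?M i \<omega> * ?M j \<omega>) \<omega> =
        cexp P t (\<lambda>\<omega>. (?d * ?X i \<omega> - jump_prob t \<omega> j * ?X i \<omega>) - jump_prob t \<omega> i * ?M j \<omega>) \<omega>"
      by (rule cexp_cong[OF E]) (intro adapted_diff a, use eq in auto)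
    moreover note cexp_diff[OF E adapted_diff[OF a(1,2)] a(3)] cexp_diff[OF E a(1,2)]
      cexp_mult[OF E adapted_const[of t ?d] adT(1)[of i]] cexp_mult[OF E p[of j] adT(1)[of i]]
      cexp_mult[OF E p[of i] adT(2)[of j]] cexp_M_diff[OF assms, of j]
    ultimately show ?thesis by eventually_elim simp
  qed
  then have "AE \<omega> in P. \<forall>i\<in>UNIV. \<forall>j\<in>UNIV. cexp P t (\<lambda>\<omega>. ?M i \<omega> * ?M j \<omega>) \<omega>
      = (if i = j then jump_prob t \<omega> i else 0) - jump_prob t \<omega> i * jump_prob t \<omega> j"
    by (intro AE_finite_allI finite)
  then show ?thesis by eventually_elim (simp add: psi_def vec_eq_iff)
qed

lemma adapted_psi: "t < T \<Longrightarrow> adapted t (psi P X t)"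
  by (intro adapted_vec) (simp add: psi_def adapted_cexp)

text \<open>The vectors satisfying \<open>jump_vec\<close> form the range of \<open>psi\<close>.\<close>

definition jump_vec :: "nat \<Rightarrow> 'a \<Rightarrow> real^'m \<Rightarrow> bool" where
  "jump_vec t \<omega> v \<longleftrightarrow> (\<Sum>j\<in>UNIV. v $ j) = 0 \<and> (\<forall>i. jump_prob t \<omega> i = 0 \<longrightarrow> v $ i = 0)"

text \<open>The increment of \<open>M\<close> itself lies in the range of \<open>psi\<close>, and on
  that range the pseudoinverse is a genuine right inverse. These two facts make the passage between
  vector processes and density factors work in both directions.\<close>

lemma psi_algebra:
  assumes "t < T"
  shows "AE \<omega> in P. jump_vec t \<omega> (M_diff P X (Suc t) \<omega>) \<and>
    transpose (psi P X t \<omega>) = psi P X t \<omega> \<and>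
    transpose (moore_penrose (psi P X t \<omega>)) = moore_penrose (psi P X t \<omega>) \<and>
    (\<forall>w. jump_vec t \<omega> (psi P X t \<omega> *v w)) \<and>
    (\<forall>v. jump_vec t \<omega> v \<longrightarrow> psi P X t \<omega> *v (moore_penrose (psi P X t \<omega>) *v v) = v)"
  using psi_eq[OF assms] jump_prob_distribution[OF assms] AE_space
proof eventually_elim
  case (elim \<omega>)
  define p where "p = jump_prob t \<omega>"
  define A :: "real^'m^'m" where "A = (\<chi> i j. (if i = j then p i else 0) - p i * p j)"
  have A: "psi P X t \<omega> = A" unfolding A_def p_def by (rule elim(1))
  have p: "p i \<ge> 0" "(\<Sum>i\<in>UNIV. p i) = 1" "p i = 0 \<Longrightarrow> X (Suc t) \<omega> $ i = 0" for i
    using elim by (auto simp: p_def)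
  have "jump_vec t \<omega> (M_diff P X (Suc t) \<omega>)"
    using p(2,3) X_nth(2)[of "Suc t" \<omega>] elim assms
    by (auto simp: jump_vec_def M_diff_nth sum_subtractf p_def)
  moreover have "transpose A = A" by (auto simp: A_def transpose_def vec_eq_iff)
  moreover have "jump_vec t \<omega> (A *v w)" for w
  proof -
    have Aw: "(A *v w) $ i = p i * w $ i - p i * (\<Sum>j\<in>UNIV. p j * w $ j)" for i
    proof -
      have "(A *v w) $ i = (\<Sum>j\<in>UNIV. (if i = j then p i * w $ j else 0) - p i * (p j * w $ j))"
        unfolding A_def matrix_vector_mult_def vec_lambda_beta
        by (intro sum.cong) (auto simp: algebra_simps)
      then show ?thesis
        by (simp only: sum_subtractf sum_distrib_left[symmetric] sum.delta'[OF finite]) simp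
    qed
    have "(\<Sum>i\<in>UNIV. (A *v w) $ i) = 0"
      by (simp add: Aw sum_subtractf p(2) flip: sum_distrib_right)
    moreover have "jump_prob t \<omega> i = p i" for i by (simp add: p_def)
    ultimately show ?thesis by (simp add: jump_vec_def Aw)
  qed
  ultimately show ?case
    using moore_penrose_covariance[of p, OF p(1,2)]
    unfolding A A_def[symmetric] by (simp add: jump_vec_def p_def)
qed

section \<open>Martingale representation of one-step variables\<close>

lemma history_Suc: "history (Suc t) \<omega> = (history t \<omega>)(Suc t := X (Suc t) \<omega>)"
  by (auto simp: history_def fun_eq_iff)

text \<open>The coefficient is delivered as a function of the history rather than as a process,
  because the driver will later be evaluated separately at each of its values.\<close>

lemma martingale_representation:
  fixes h :: "'a \<Rightarrow> real"
  assumes "t < T" "adapted (Suc t) h"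
  obtains \<zeta> where
    "AE \<omega> in P. h \<omega> - cexp P t h \<omega> = \<zeta> (history t \<omega>) \<bullet> M_diff P X (Suc t) \<omega>"
proof -
  have t: "t \<le> T" "Suc t \<le> T" using assms by auto
  note E = equivalent_prob_self t(1)
  obtain \<gamma> where \<gamma>: "AE \<omega> in P. h \<omega> = \<gamma> (history (Suc t) \<omega>)"
    using assms(2) by (auto simp: adapted_def)
  \<comment> \<open>Coordinate \<open>i\<close> is the value of \<open>h\<close> if the path
    continues by a jump to \<open>axis i 1\<close>; pairing with the next state selects the value
    that actually occurs.\<close>
  define \<zeta> :: "(nat \<Rightarrow> real^'m) \<Rightarrow> real^'m" where "\<zeta> y = (\<chi> i. \<gamma> (y(Suc t := axis i 1)))" for y
  let ?z = "\<lambda>i \<omega>. \<zeta> (history t \<omega>) $ i"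
  have z: "adapted t (?z i)" for i
    using adapted_comp[OF adapted_history] .
  have h: "AE \<omega> in P. h \<omega> = (\<Sum>i\<in>UNIV. ?z i \<omega> * X (Suc t) \<omega> $ i)"
    using \<gamma> AE_space
  proof eventually_elim
    case (elim \<omega>)
    obtain k where k: "X (Suc t) \<omega> = axis k 1" using X_basis t elim by blast
    have "(\<Sum>i\<in>UNIV. ?z i \<omega> * X (Suc t) \<omega> $ i) = \<zeta> (history t \<omega>) \<bullet> X (Suc t) \<omega>"
      by (simp add: inner_vec_def)
    also have "\<dots> = h \<omega>"
      using elim by (simp add: k inner_axis \<zeta>_def history_Suc)
    finally show ?case by simp
  qed
  have a: "adapted T (\<lambda>\<omega>. \<Sum>i\<in>UNIV. ?z i \<omega> * X (Suc t) \<omega> $ i)"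
    by (intro adapted_sum adapted_mult adapted_X_nth t adapted_mono[OF z]) auto
  have "AE \<omega> in P. cexp P t (\<lambda>\<omega>. \<Sum>i\<in>UNIV. ?z i \<omega> * X (Suc t) \<omega> $ i) \<omega> = (\<Sum>i\<in>UNIV. ?z i \<omega> * jump_prob t \<omega> i)"
    by (rule cexp_linear_comb[OF E z adapted_X_nth[OF t(2)] finite])
  then have "AE \<omega> in P. h \<omega> - cexp P t h \<omega> = \<zeta> (history t \<omega>) \<bullet> M_diff P X (Suc t) \<omega>"
    using h cexp_cong[OF E a h]
    by eventually_elim (simp add: inner_vec_def M_diff_nth right_diff_distrib sum_subtractf)
  then show ?thesis by (rule that)
qed

end

section \<open>Densities of equivalent measures\<close>

lemma inner_matrix_vector_transpose: "x \<bullet> (A *v y) = (transpose A *v x) \<bullet> (y :: real^'n)"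
  for A :: "real^'n^'m"
  by (simp add: dot_lmul_matrix)

context finite_state_process
begin

section \<open>From vector processes to measures\<close>

lemma Q_vector_process_adapted:
  "Q_vector_process P X T \<theta> \<Longrightarrow> t < T \<Longrightarrow> adapted t (\<theta> t)"
  by (rule adapted_filt_vec) (auto simp: Q_vector_process_def)

lemma adapted_density_factor:
  assumes "t < T" "adapted t \<tau>"
  shows "adapted (Suc t) (\<lambda>\<omega>. 1 + \<tau> \<omega> \<bullet> (moore_penrose (psi P X t \<omega>) *v M_diff P X (Suc t) \<omega>))"
proof -
  \<comment> \<open>The pseudoinverse, given by a definite description, enters as a mere function of
    \<open>psi\<close>; adaptedness is preserved by arbitrary functions.\<close>
  have "adapted (Suc t) \<tau>" "adapted (Suc t) (\<lambda>\<omega>. moore_penrose (psi P X t \<omega>))"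
    by (rule adapted_mono[OF assms(2)], simp)
       (rule adapted_mono[OF adapted_comp[OF adapted_psi[OF assms(1)]]], simp)
  from adapted_comp2[OF this(1) adapted_comp2[OF this(2) adapted_M_diff[OF assms(1)], of "(*v)"],
      of "\<lambda>x y. 1 + x \<bullet> y"]
  show ?thesis .
qed

text \<open>By symmetry of the pseudoinverse the factor is almost surely one plus the inner product
  of the F_t-variable \<open>u\<close> with the increment. Its conditional mean is thus one, and its
  conditional mean against the increment is \<open>psi\<close> applied to \<open>u\<close>, which is
  \<open>\<tau>\<close> because \<open>\<tau>\<close> lies in the range of
  \<open>psi\<close>.\<close>

lemma density_factor_cexp:
  assumes t: "t < T" and \<tau>: "adapted t \<tau>" "AE \<omega> in P. jump_vec t \<omega> (\<tau> \<omega>)"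
  defines "N \<equiv> (\<lambda>\<omega>. 1 + \<tau> \<omega> \<bullet> (moore_penrose (psi P X t \<omega>) *v M_diff P X (Suc t) \<omega>))"
  shows "AE \<omega> in P. cexp P t N \<omega> = 1"
    and "AE \<omega> in P. cexp P t (\<lambda>\<omega>. N \<omega> * M_diff P X (Suc t) \<omega> $ i) \<omega> = \<tau> \<omega> $ i"
proof -
  have tT: "t \<le> T" "Suc t \<le> T" using t by auto
  note E = equivalent_prob_self tT(1)
  let ?M = "\<lambda>i \<omega>. M_diff P X (Suc t) \<omega> $ i"
  have M: "adapted T (?M i)" for i by (rule adapted_M_diff_nth[OF t tT(2)])
  define u where "u \<omega> = moore_penrose (psi P X t \<omega>) *v \<tau> \<omega>" for \<omega>
  have "adapted t u"
    using adapted_comp2[OF adapted_psi[OF t] \<tau>(1), of "\<lambda>A x. moore_penrose A *v x"]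
    by (simp add: u_def[abs_def])
  from adapted_comp[OF this] have u: "adapted t (\<lambda>\<omega>. u \<omega> $ i)" for i .
  have N: "AE \<omega> in P. N \<omega> = 1 + (\<Sum>j\<in>UNIV. u \<omega> $ j * ?M j \<omega>)"
    using psi_algebra[OF t]
  proof eventually_elim
    case (elim \<omega>)
    have "N \<omega> = 1 + u \<omega> \<bullet> M_diff P X (Suc t) \<omega>"
      using elim unfolding N_def u_def by (subst inner_matrix_vector_transpose) simp
    then show ?case by (simp add: inner_vec_def)
  qed
  have a: "adapted T (\<lambda>\<omega>. \<Sum>j\<in>UNIV. u \<omega> $ j * ?M j \<omega>)"
    by (intro adapted_sum adapted_mult adapted_mono[OF u tT(1)] M finite)
  have "AE \<omega> in P. cexp P t (\<lambda>\<omega>. \<Sum>j\<in>UNIV. u \<omega> $ j * ?M j \<omega>) \<omega> = (\<Sum>j\<in>UNIV. u \<omega> $ j * cexp P t (?M j) \<omega>)"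
    by (rule cexp_linear_comb[OF E u M finite])
  moreover have "AE \<omega> in P. \<forall>j\<in>UNIV. cexp P t (?M j) \<omega> = 0"
    by (intro AE_finite_allI cexp_M_diff[OF t] finite)
  moreover note cexp_cong[OF E adapted_add[OF adapted_const a] N]
    cexp_add[OF E adapted_const[of T 1] a] cexp_adapted[OF E adapted_const[of t 1]]
  ultimately show "AE \<omega> in P. cexp P t N \<omega> = 1" by eventually_elim simp
  have a2: "adapted T (\<lambda>\<omega>. \<Sum>j\<in>UNIV. u \<omega> $ j * (?M i \<omega> * ?M j \<omega>))"
    by (intro adapted_sum adapted_mult adapted_mono[OF u tT(1)] M finite)
  have N2: "AE \<omega> in P. N \<omega> * ?M i \<omega> = ?M i \<omega> + (\<Sum>j\<in>UNIV. u \<omega> $ j * (?M i \<omega> * ?M j \<omega>))"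
    using N by eventually_elim (simp add: algebra_simps sum_distrib_left)
  have "AE \<omega> in P. cexp P t (\<lambda>\<omega>. \<Sum>j\<in>UNIV. u \<omega> $ j * (?M i \<omega> * ?M j \<omega>)) \<omega>
     = (\<Sum>j\<in>UNIV. u \<omega> $ j * cexp P t (\<lambda>\<omega>. ?M i \<omega> * ?M j \<omega>) \<omega>)"
    by (rule cexp_linear_comb[OF E u adapted_mult[OF M M] finite])
  moreover note cexp_cong[OF E adapted_add[OF M[of i] a2] N2] cexp_add[OF E M[of i] a2] cexp_M_diff[OF t, of i]
    psi_algebra[OF t] \<tau>(2)
  ultimately show "AE \<omega> in P. cexp P t (\<lambda>\<omega>. N \<omega> * ?M i \<omega>) \<omega> = \<tau> \<omega> $ i"
  proof eventually_elim
    case (elim \<omega>)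
    have "(\<Sum>j\<in>UNIV. u \<omega> $ j * cexp P t (\<lambda>\<omega>. ?M i \<omega> * ?M j \<omega>) \<omega>) = (psi P X t \<omega> *v u \<omega>) $ i"
      by (simp add: matrix_vector_mult_def psi_def mult.commute)
    also have "\<dots> = \<tau> \<omega> $ i" using elim by (simp add: u_def)
    finally show ?case using elim by simp
  qed
qed

lemma Q_vector_process_jump_vec:
  assumes "Q_vector_process P X T \<theta>" "t < T"
  shows "AE \<omega> in P. jump_vec t \<omega> (\<theta> t \<omega>)"
proof -
  have "AE \<omega> in P. (\<Sum>j\<in>UNIV. \<theta> t \<omega> $ j) = 0"
    "AE \<omega> in P. \<forall>i. i \<notin> possible_jumps P X t \<omega> \<longrightarrow> \<theta> t \<omega> $ i = 0"
    using assms by (auto simp: Q_vector_process_def)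
  with possible_jumps_iff[OF assms(2)] show ?thesis
    by eventually_elim (simp add: jump_vec_def)
qed

text \<open>Bayes' formula for the density process \<open>D\<close>. Integrals of F_(t+1)-variables
  see only \<open>D (Suc t)\<close>, which is \<open>D t\<close> times the factor
  \<open>N t\<close>; conditioning \<open>N t\<close> times the increment on F_t gives
  \<open>\<theta> t\<close>, and the remaining \<open>D t\<close> is exchanged for
  \<open>D T\<close> again.\<close>

lemma Q_measure_cexp_M_diff:
  assumes \<theta>: "Q_vector_process P X T \<theta>" and Q: "equivalent_prob P (Q_measure P X T \<theta>)" and t: "t < T"
  shows "AE \<omega> in P. cexp (Q_measure P X T \<theta>) t (\<lambda>\<omega>. M_diff P X (Suc t) \<omega> $ i) \<omega> = \<theta> t \<omega> $ i"
proof -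
  define N where "N s \<omega> = 1 + \<theta> s \<omega> \<bullet> (moore_penrose (psi P X s \<omega>) *v M_diff P X (Suc s) \<omega>)" for s \<omega>
  define D where "D k \<omega> = (\<Prod>s<k. N s \<omega>)" for k \<omega>
  have tT: "t \<le> T" "Suc t \<le> T" using t by auto
  have ad\<theta>: "adapted s (\<theta> s)" if "s < T" for s using Q_vector_process_adapted[OF \<theta> that] .
  have adN: "adapted (Suc s) (N s)" if "s < T" for s
    unfolding N_def[abs_def] by (rule adapted_density_factor[OF that ad\<theta>[OF that]])
  have adD: "adapted k (D k)" if "k \<le> T" for k
    unfolding D_def[abs_def]
    by (rule adapted_prod, simp) (rule adapted_mono[OF adN], use that in auto)
  have cexpN: "AE \<omega> in P. cexp P s (N s) \<omega> = 1" if "s < T" for s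
    unfolding N_def[abs_def]
    by (rule density_factor_cexp(1)[OF that ad\<theta>[OF that] Q_vector_process_jump_vec[OF \<theta> that]])
  have cexpNM: "AE \<omega> in P. cexp P t (\<lambda>\<omega>. N t \<omega> * M_diff P X (Suc t) \<omega> $ i) \<omega> = \<theta> t \<omega> $ i"
    unfolding N_def[abs_def]
    by (rule density_factor_cexp(2)[OF t ad\<theta>[OF t] Q_vector_process_jump_vec[OF \<theta> t]])
  have dens: "Q_measure P X T \<theta> = density P (\<lambda>\<omega>. ennreal (D T \<omega>))"
    by (simp add: Q_measure_def Q_density_def D_def N_def)
  have Dm[measurable]: "D T \<in> borel_measurable P" by (rule adapted_measurable[OF adD[OF order_refl] order_refl])
  \<comment> \<open>The truncated density is positive almost surely under the measure that it
    defines. Equivalence carries this back to \<open>P\<close>, so the cut-off by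
    \<open>ennreal\<close> changes the density only on a null set.\<close>
  have "AE \<omega> in Q_measure P X T \<theta>. 0 < D T \<omega>"
    unfolding dens by (subst AE_density) auto
  then have Dpos: "AE \<omega> in P. 0 \<le> D T \<omega>"
    unfolding AE_equivalent[OF Q] by eventually_elim simp
  have intQ: "(\<integral>\<omega>. g \<omega> \<partial>Q_measure P X T \<theta>) = (\<integral>\<omega>. g \<omega> * D T \<omega> \<partial>P)"
    if "adapted T g" for g :: "'a \<Rightarrow> real"
    unfolding dens using adapted_measurable[OF that order_refl] Dpos
    by (subst integral_density) (auto simp: mult.commute)
  \<comment> \<open>The martingale property of \<open>D\<close>, in integrated form: each further
    factor has conditional mean one.\<close>
  have shift: "(\<integral>\<omega>. h \<omega> * D n \<omega> \<partial>P) = (\<integral>\<omega>. h \<omega> * D k \<omega> \<partial>P)"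
    if "k \<le> n" "n \<le> T" "adapted k h" for k n and h :: "'a \<Rightarrow> real"
    using that(1,2)
  proof (induction n rule: dec_induct)
    case (step n)
    then have n: "n < T" "n \<le> T" "Suc n \<le> T" by auto
    have a: "adapted n (\<lambda>\<omega>. h \<omega> * D n \<omega>)"
      by (intro adapted_mult adD n adapted_mono[OF that(3) step(1)])
    have "(\<integral>\<omega>. h \<omega> * D (Suc n) \<omega> \<partial>P) = (\<integral>\<omega>. (h \<omega> * D n \<omega>) * N n \<omega> \<partial>P)"
      by (simp add: D_def mult.assoc)
    also have "\<dots> = (\<integral>\<omega>. (h \<omega> * D n \<omega>) * cexp P n (N n) \<omega> \<partial>P)"
      by (rule cexp_integral[symmetric, OF equivalent_prob_self n(2) a adapted_mono[OF adN[OF n(1)] n(3)]])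
    also have "\<dots> = (\<integral>\<omega>. h \<omega> * D n \<omega> \<partial>P)"
      using cexpN[OF n(1)] adapted_measurable[OF a n(2)] adapted_measurable[OF adapted_cexp[OF n(2)] n(2)]
      by (intro integral_cong_AE) auto
    finally show ?case using step n by simp
  qed simp
  show ?thesis
  proof (rule cexp_charact[OF Q tT(1)])
    show a\<theta>: "adapted t (\<lambda>\<omega>. \<theta> t \<omega> $ i)" by (rule adapted_comp[OF ad\<theta>[OF t]])
    show aM: "adapted T (\<lambda>\<omega>. M_diff P X (Suc t) \<omega> $ i)" by (rule adapted_M_diff_nth[OF t tT(2)])
    fix A assume A: "A \<in> sets (filt P X t)"
    have ind: "adapted t (indicator A :: 'a \<Rightarrow> real)" by (rule adapted_indicator[OF A tT(1)])
    let ?I = "indicator A :: 'a \<Rightarrow> real"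
    let ?M = "\<lambda>\<omega>. M_diff P X (Suc t) \<omega> $ i"
    have aI: "adapted (Suc t) (\<lambda>\<omega>. ?I \<omega> * ?M \<omega>)"
      by (intro adapted_mult adapted_mono[OF ind] adapted_M_diff_nth t) auto
    have aID: "adapted t (\<lambda>\<omega>. ?I \<omega> * D t \<omega>)" by (intro adapted_mult ind adD tT)
    have aI\<theta>: "adapted t (\<lambda>\<omega>. ?I \<omega> * \<theta> t \<omega> $ i)" by (intro adapted_mult ind a\<theta>)
    have aNM: "adapted T (\<lambda>\<omega>. N t \<omega> * ?M \<omega>)" by (intro adapted_mult aM adapted_mono[OF adN[OF t] tT(2)])
    have "(\<integral>\<omega>. ?I \<omega> * ?M \<omega> \<partial>Q_measure P X T \<theta>) = (\<integral>\<omega>. (?I \<omega> * ?M \<omega>) * D T \<omega> \<partial>P)"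
      by (rule intQ[OF adapted_mono[OF aI tT(2)]])
    also have "\<dots> = (\<integral>\<omega>. (?I \<omega> * ?M \<omega>) * D (Suc t) \<omega> \<partial>P)"
      by (rule shift[OF tT(2) order_refl aI])
    also have "\<dots> = (\<integral>\<omega>. (?I \<omega> * D t \<omega>) * (N t \<omega> * ?M \<omega>) \<partial>P)"
      by (simp add: D_def mult_ac)
    also have "\<dots> = (\<integral>\<omega>. (?I \<omega> * D t \<omega>) * cexp P t (\<lambda>\<omega>. N t \<omega> * ?M \<omega>) \<omega> \<partial>P)"
      by (rule cexp_integral[symmetric, OF equivalent_prob_self tT(1) aID aNM])
    also have "\<dots> = (\<integral>\<omega>. (?I \<omega> * \<theta> t \<omega> $ i) * D t \<omega> \<partial>P)"
      using cexpNM adapted_measurable[OF aID tT(1)] adapted_measurable[OF a\<theta> tT(1)]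
        adapted_measurable[OF aI\<theta> tT(1)] adapted_measurable[OF adD[OF tT(1)] tT(1)]
      by (intro integral_cong_AE) (auto elim!: eventually_mono)
    also have "\<dots> = (\<integral>\<omega>. (?I \<omega> * \<theta> t \<omega> $ i) * D T \<omega> \<partial>P)"
      by (rule shift[symmetric, OF tT(1) order_refl aI\<theta>])
    also have "\<dots> = (\<integral>\<omega>. ?I \<omega> * \<theta> t \<omega> $ i \<partial>Q_measure P X T \<theta>)"
      by (rule intQ[symmetric, OF adapted_mono[OF aI\<theta> tT(1)]])
    finally show "(\<integral>\<omega>. ?I \<omega> * ?M \<omega> \<partial>Q_measure P X T \<theta>) = (\<integral>\<omega>. ?I \<omega> * \<theta> t \<omega> $ i \<partial>Q_measure P X T \<theta>)" .
  qed
qed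

text \<open>The Radon-Nikodym density is split into ratios of successive conditional densities
  \<open>Ds\<close>. Each ratio is one plus a martingale increment divided by \<open>Ds t\<close>,
  and the representation theorem turns it into a factor of the required form.\<close>

lemma Q_measure_surj:
  assumes Q: "equivalent_prob P Q"
  obtains \<theta> where "Q_vector_process P X T \<theta>" "Q_measure P X T \<theta> = Q"
proof -
  interpret Q: prob_space Q using Q by (simp add: equivalent_prob_def)
  have ac: "absolutely_continuous P Q" "sets Q = sets P" using Q by (auto simp: equivalent_prob_def)
  obtain D where D[measurable]: "D \<in> borel_measurable P"
    and RN: "AE \<omega> in P. RN_deriv P Q \<omega> = ennreal (D \<omega>)"
    and pos: "AE \<omega> in Q. 0 < D \<omega>" "\<And>\<omega>. 0 \<le> D \<omega>"
    using real_RN_deriv[OF Q.finite_measure_axioms ac] by blast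
  have pos: "AE \<omega> in P. 0 < D \<omega>" using pos by (simp add: AE_equivalent[OF Q])
  have dens: "Q = density P (\<lambda>\<omega>. ennreal (D \<omega>))"
    using density_RN_deriv[OF ac] density_cong[OF _ _ RN] by simp
  have aD: "adapted T D" by (rule adapted_P_real[OF D])
  define Ds where "Ds t = cexp P t D" for t
  have aDs: "adapted t (Ds t)" if "t \<le> T" for t unfolding Ds_def by (rule adapted_cexp[OF that])
  have Dspos: "AE \<omega> in P. 0 < Ds t \<omega>" if "t \<le> T" for t
  proof -
    interpret sigma_finite_subalgebra P "filt P X t"
      by (rule sigma_finite_subalgebra_equivalent[OF equivalent_prob_self that])
    show ?thesis unfolding Ds_def
      by (rule real_cond_exp_gr_c[OF adapted_integrable[OF equivalent_prob_self aD order_refl] pos])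
  qed
  have DsT: "AE \<omega> in P. Ds T \<omega> = D \<omega>"
    unfolding Ds_def by (rule cexp_adapted[OF equivalent_prob_self order_refl aD])
  \<comment> \<open>The telescoping product leaves a division by \<open>Ds 0\<close>. Equivalent
    measures agree on events of probability zero or one, hence on all of F_0, so this value is
    one.\<close>
  have Ds0: "AE \<omega> in P. Ds 0 \<omega> = 1"
    unfolding Ds_def
  proof (rule cexp_charact[OF equivalent_prob_self _ adapted_const aD])
    fix A assume A: "A \<in> sets (filt P X 0)"
    then have AP[measurable]: "A \<in> sets P" using subalgebra_filt[of 0] by (auto simp: subalgebra_def)
    have PA: "measure P A = 0 \<or> measure P A = 1" by (rule F0_trivial[OF A])
    have "measure Q A = measure P A"
    proof (cases "measure P A = 0")
      case True
      then have "A \<in> null_sets P" using AP by (auto simp: emeasure_eq_measure)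
      then have "A \<in> null_sets Q" using ac by (auto simp: absolutely_continuous_def)
      then show ?thesis using True by (auto simp: Q.emeasure_eq_measure)
    next
      case False
      then have "AE \<omega> in P. \<omega> \<in> A" using PA by (simp add: prob_eq_1)
      then have "AE \<omega> in Q. \<omega> \<in> A" by (simp add: AE_equivalent[OF Q])
      then have "measure Q A = 1" using ac by (simp add: Q.prob_eq_1)
      then show ?thesis using False PA by simp
    qed
    moreover have "(\<integral>\<omega>. indicator A \<omega> \<partial>Q) = (\<integral>\<omega>. indicator A \<omega> * D \<omega> \<partial>P)"
      unfolding dens using pos
      by (subst integral_density) (auto simp: mult.commute)
    ultimately show "(\<integral>\<omega>. indicator A \<omega> * D \<omega> \<partial>P) = (\<integral>\<omega>. indicator A \<omega> * 1 \<partial>P)"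
      using ac AP sets.sets_into_space[OF AP] sets_eq_imp_space_eq[OF ac(2)]
      by (simp add: Int_absorb2)
  qed simp
  have "\<exists>\<theta>. \<theta> \<in> borel_measurable (filt P X t) \<and> (AE \<omega> in P. jump_vec t \<omega> (\<theta> \<omega>)) \<and>
     (AE \<omega> in P. 1 + \<theta> \<omega> \<bullet> (moore_penrose (psi P X t \<omega>) *v M_diff P X (Suc t) \<omega>) = Ds (Suc t) \<omega> / Ds t \<omega>)"
    if t: "t < T" for t
  proof -
    have tT: "t \<le> T" "Suc t \<le> T" using t by auto
    obtain \<zeta> where \<zeta>: "AE \<omega> in P. Ds (Suc t) \<omega> - cexp P t (Ds (Suc t)) \<omega>
        = \<zeta> (history t \<omega>) \<bullet> M_diff P X (Suc t) \<omega>"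
      by (rule martingale_representation[OF t aDs[OF tT(2)]])
    \<comment> \<open>By Bayes' formula this is the conditional mean of the increment under
      \<open>Q\<close>: the conditional mean of \<open>Ds (Suc t)\<close> times the increment is
      \<open>psi\<close> applied to \<open>\<zeta>\<close>. A version of \<open>\<tau>\<close> is
      taken because a vector process must be measurable for \<open>filt P X t\<close>.\<close>
    define \<tau> where "\<tau> \<omega> = (1 / Ds t \<omega>) *\<^sub>R (psi P X t \<omega> *v \<zeta> (history t \<omega>))" for \<omega>
    have "adapted t (\<lambda>\<omega>. psi P X t \<omega> *v \<zeta> (history t \<omega>))"
      by (rule adapted_comp2[OF adapted_psi[OF t] adapted_comp[OF adapted_history]])
    from adapted_comp2[OF aDs[OF tT(1)] this, of "\<lambda>a v. (1 / a) *\<^sub>R v"]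
    have "adapted t \<tau>" by (simp add: \<tau>_def[abs_def])
    then obtain \<theta> where \<theta>: "\<theta> \<in> borel_measurable (filt P X t)" "AE \<omega> in P. \<tau> \<omega> = \<theta> \<omega>"
      using adapted_version tT by blast
    have "AE \<omega> in P. jump_vec t \<omega> (\<theta> \<omega>)"
      using psi_algebra[OF t] \<theta>(2)
    proof eventually_elim
      case (elim \<omega>)
      then have j: "jump_vec t \<omega> (psi P X t \<omega> *v \<zeta> (history t \<omega>))" by blast
      show ?case using j unfolding elim(2)[symmetric] \<tau>_def
        by (simp add: jump_vec_def flip: sum_divide_distrib)
    qed
    moreover have "AE \<omega> in P. cexp P t (Ds (Suc t)) \<omega> = Ds t \<omega>"
      unfolding Ds_def by (rule cexp_tower[OF equivalent_prob_self _ tT(2) aD]) simp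
    with \<zeta> psi_algebra[OF t] \<theta>(2) Dspos[OF tT(1)]
    have "AE \<omega> in P. 1 + \<theta> \<omega> \<bullet> (moore_penrose (psi P X t \<omega>) *v M_diff P X (Suc t) \<omega>) = Ds (Suc t) \<omega> / Ds t \<omega>"
    proof eventually_elim
      case (elim \<omega>)
      let ?A = "psi P X t \<omega>" and ?M = "M_diff P X (Suc t) \<omega>" and ?z = "\<zeta> (history t \<omega>)"
      \<comment> \<open>By symmetry \<open>psi\<close> moves to the other side, where it cancels its
        pseudoinverse because the increment lies in its range.\<close>
      have "(?A *v ?z) \<bullet> (moore_penrose ?A *v ?M) = ?z \<bullet> (?A *v (moore_penrose ?A *v ?M))"
        using elim(2) inner_matrix_vector_transpose[of ?z ?A "moore_penrose ?A *v ?M"] by metis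
      also have "\<dots> = Ds (Suc t) \<omega> - Ds t \<omega>" using elim by simp
      finally have "1 + \<theta> \<omega> \<bullet> (moore_penrose ?A *v ?M) = 1 + (Ds (Suc t) \<omega> - Ds t \<omega>) / Ds t \<omega>"
        unfolding elim(3)[symmetric] \<tau>_def by simp
      then show ?case using elim(4) by (simp add: field_simps)
    qed
    ultimately show ?thesis using \<theta>(1) by blast
  qed
  then have "\<forall>t\<in>{..<T}. \<exists>\<theta>. \<theta> \<in> borel_measurable (filt P X t) \<and> (AE \<omega> in P. jump_vec t \<omega> (\<theta> \<omega>)) \<and>
     (AE \<omega> in P. 1 + \<theta> \<omega> \<bullet> (moore_penrose (psi P X t \<omega>) *v M_diff P X (Suc t) \<omega>) = Ds (Suc t) \<omega> / Ds t \<omega>)"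
    by blast
  from bchoice[OF this] obtain \<theta> where "\<forall>t\<in>{..<T}. \<theta> t \<in> borel_measurable (filt P X t) \<and> (AE \<omega> in P. jump_vec t \<omega> (\<theta> t \<omega>)) \<and>
     (AE \<omega> in P. 1 + \<theta> t \<omega> \<bullet> (moore_penrose (psi P X t \<omega>) *v M_diff P X (Suc t) \<omega>) = Ds (Suc t) \<omega> / Ds t \<omega>)"
    by blast
  then have \<theta>: "\<And>t. t < T \<Longrightarrow> \<theta> t \<in> borel_measurable (filt P X t)"
    "\<And>t. t < T \<Longrightarrow> AE \<omega> in P. jump_vec t \<omega> (\<theta> t \<omega>)"
    "\<And>t. t < T \<Longrightarrow> AE \<omega> in P. 1 + \<theta> t \<omega> \<bullet> (moore_penrose (psi P X t \<omega>) *v M_diff P X (Suc t) \<omega>) = Ds (Suc t) \<omega> / Ds t \<omega>"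
    by auto
  have vp: "Q_vector_process P X T \<theta>"
    unfolding Q_vector_process_def
  proof (intro allI impI conjI)
    fix t assume t: "t < T"
    show "\<theta> t \<in> borel_measurable (filt P X t)" by (rule \<theta>(1)[OF t])
    show "integrable P (\<theta> t)"
      using adapted_integrable[OF equivalent_prob_self adapted_filt_vec[OF \<theta>(1)[OF t]]] t by simp
    show "AE \<omega> in P. (\<Sum>j\<in>UNIV. \<theta> t \<omega> $ j) = 0"
      using \<theta>(2)[OF t] by eventually_elim (simp add: jump_vec_def)
    show "AE \<omega> in P. \<forall>i. i \<notin> possible_jumps P X t \<omega> \<longrightarrow> \<theta> t \<omega> $ i = 0"
      using \<theta>(2)[OF t] possible_jumps_iff[OF t] by eventually_elim (simp add: jump_vec_def)
  qed
  have "AE \<omega> in P. (\<Prod>s<n. 1 + \<theta> s \<omega> \<bullet> (moore_penrose (psi P X s \<omega>) *v M_diff P X (Suc s) \<omega>)) = Ds n \<omega>"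
    if "n \<le> T" for n
    using that
  proof (induction n)
    case 0
    then show ?case using Ds0 by simp
  next
    case (Suc n)
    then have "AE \<omega> in P. (\<Prod>s<n. 1 + \<theta> s \<omega> \<bullet> (moore_penrose (psi P X s \<omega>) *v M_diff P X (Suc s) \<omega>)) = Ds n \<omega>" by simp
    then show ?case
      using \<theta>(3)[of n, OF Suc_le_lessD[OF Suc.prems]] Dspos[OF Suc_leD[OF Suc.prems]]
      by eventually_elim simp
  qed
  from this[OF order_refl] DsT have eq: "AE \<omega> in P. Q_density P X T \<theta> \<omega> = D \<omega>"
    unfolding Q_density_def by eventually_elim simp
  have "Q_density P X T \<theta> \<in> borel_measurable P" by (rule measurable_P_AE[OF D eq])
  then have "Q_measure P X T \<theta> = Q"
    unfolding Q_measure_def dens using eq by (intro density_cong) auto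
  with vp show ?thesis by (rule that)
qed

end

section \<open>Essential infima and pasting of measures\<close>

lemma is_ess_inf_lower: "is_ess_inf P S g \<Longrightarrow> h \<in> S \<Longrightarrow> AE \<omega> in P. g \<omega> \<le> h \<omega>"
  unfolding is_ess_inf_def by blast

lemma is_ess_inf_greatest:
  "is_ess_inf P S g \<Longrightarrow> g' \<in> borel_measurable P \<Longrightarrow> (\<And>h. h \<in> S \<Longrightarrow> AE \<omega> in P. g' \<omega> \<le> h \<omega>)
    \<Longrightarrow> AE \<omega> in P. g' \<omega> \<le> g \<omega>"
  unfolding is_ess_inf_def by blast

context finite_state_process
begin

section \<open>Essential infima over arbitrary families\<close>

lemma ess_inf_exists:
  assumes t: "t \<le> T" and S: "S \<noteq> {}" and ad: "\<And>h. h \<in> S \<Longrightarrow> adapted t h"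
    and c: "\<And>h. h \<in> S \<Longrightarrow> AE \<omega> in P. c \<le> h \<omega>"
  shows "\<exists>g. g \<in> borel_measurable (filt P X t) \<and> is_ess_inf P S g"
proof -
  obtain \<gamma> where \<gamma>: "\<And>h. h \<in> S \<Longrightarrow> AE \<omega> in P. h \<omega> = \<gamma> h (history t \<omega>)"
    using ad unfolding adapted_def by metis
  \<comment> \<open>The infimum is taken pointwise over representing functions of the history. The
    bound \<open>c\<close> makes it a true infimum on every history of positive probability;
    elsewhere its value is irrelevant almost surely.\<close>
  define G where "G y = Inf ((\<lambda>h. \<gamma> h y) ` S)" for y
  let ?pos = "\<lambda>t y. measure P {\<omega>\<in>space P. history t \<omega> = y} > 0"
  have lower: "c \<le> \<gamma> h y" if "?pos t y" "h \<in> S" for y h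
  proof -
    have "AE \<omega> in P. c \<le> \<gamma> h (history t \<omega>)"
      using \<gamma>[OF that(2)] c[OF that(2)] by eventually_elim simp
    then show ?thesis using that(1) AE_history_iff[OF t, of "\<lambda>y. c \<le> \<gamma> h y"] by blast
  qed
  have G_le: "AE \<omega> in P. G (history t \<omega>) \<le> h \<omega>" if "h \<in> S" for h
  proof -
    have "AE \<omega> in P. G (history t \<omega>) \<le> \<gamma> h (history t \<omega>)"
      by (rule AE_history_iff[OF t, of "\<lambda>y. G y \<le> \<gamma> h y", THEN iffD2])
         (use lower that in \<open>auto simp: G_def intro!: cInf_lower bdd_belowI2[of _ c]\<close>)
    with \<gamma>[OF that] show ?thesis by eventually_elim simp
  qed
  have G_ge: "AE \<omega> in P. g' \<omega> \<le> G (history t \<omega>)"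
    if g': "g' \<in> borel_measurable P" "\<forall>h\<in>S. AE \<omega> in P. g' \<omega> \<le> h \<omega>" for g' :: "'a \<Rightarrow> real"
  proof -
    \<comment> \<open>A competing lower bound is only \<open>P\<close>-measurable, so it depends on
      the whole path; the comparison is made on full paths, and \<open>?r\<close> cuts them back to
      time \<open>t\<close>.\<close>
    let ?r = "\<lambda>y r. if r \<le> t then y r else 0"
    note r = history_restrict[OF t]
    obtain \<gamma>' where \<gamma>': "AE \<omega> in P. g' \<omega> = \<gamma>' (history T \<omega>)"
      using adapted_P_real[OF g'(1)] by (auto simp: adapted_def)
    have "AE \<omega> in P. \<gamma>' (history T \<omega>) \<le> \<gamma> h (?r (history T \<omega>))" if "h \<in> S" for h
      using \<gamma>' g'(2)[rule_format, OF that] \<gamma>[OF that] by eventually_elim (simp flip: r)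
    then have "\<gamma>' y \<le> \<gamma> h (?r y)" if "?pos T y" "h \<in> S" for y h
      using that AE_history_iff[OF order_refl, of "\<lambda>y. \<gamma>' y \<le> \<gamma> h (?r y)"] by blast
    then have "AE \<omega> in P. \<gamma>' (history T \<omega>) \<le> G (?r (history T \<omega>))"
      by (intro AE_history_iff[OF order_refl, of "\<lambda>y. \<gamma>' y \<le> G (?r y)", THEN iffD2])
         (use S in \<open>auto simp: G_def intro!: cInf_greatest\<close>)
    with \<gamma>' show ?thesis by eventually_elim (simp flip: r)
  qed
  show ?thesis
    using G_le G_ge history_measurable_filt[OF t, of G] history_measurable[OF t, of G]
    unfolding is_ess_inf_def by blast
qed

text \<open>On a single history all variables involved are almost surely constant. If every member
  of \<open>S\<close> failed there, \<open>g\<close> raised by \<open>\<epsilon>\<close> on that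
  history would still be a lower bound, which forces the history to be null; but then every member
  satisfies the claim.\<close>

lemma ess_inf_approx:
  assumes t: "t \<le> T" and S: "S \<noteq> {}" and ad: "\<And>h. h \<in> S \<Longrightarrow> adapted t h"
    and g: "is_ess_inf P S g" "adapted t g" and \<epsilon>: "\<epsilon> > 0"
  shows "\<exists>h\<in>S. AE \<omega> in P. history t \<omega> = y \<longrightarrow> h \<omega> \<le> g \<omega> + \<epsilon>"
proof (rule ccontr)
  assume no: "\<not> ?thesis"
  let ?g = "\<lambda>\<omega>. g \<omega> + (if history t \<omega> = y then \<epsilon> else 0)"
  have "adapted t (\<lambda>\<omega>. if history t \<omega> = y then \<epsilon> else 0)"
    using adapted_comp[OF adapted_history] .
  then have meas: "?g \<in> borel_measurable P"
    by (rule adapted_measurable[OF adapted_add[OF g(2)] t])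
  obtain \<gamma> where \<gamma>: "AE \<omega> in P. g \<omega> = \<gamma> (history t \<omega>)" using g(2) by (auto simp: adapted_def)
  have "AE \<omega> in P. ?g \<omega> \<le> h \<omega>" if h: "h \<in> S" for h
  proof -
    obtain \<eta> where \<eta>: "AE \<omega> in P. h \<omega> = \<eta> (history t \<omega>)" using ad[OF h] by (auto simp: adapted_def)
    have less: "\<eta> y > \<gamma> y + \<epsilon>"
    proof (rule ccontr)
      assume "\<not> \<eta> y > \<gamma> y + \<epsilon>"
      then have "AE \<omega> in P. history t \<omega> = y \<longrightarrow> h \<omega> \<le> g \<omega> + \<epsilon>"
        using \<gamma> \<eta> by eventually_elim (use \<open>\<not> \<eta> y > \<gamma> y + \<epsilon>\<close> in auto)
      with no h show False by blast
    qed
    have "AE \<omega> in P. g \<omega> \<le> h \<omega>" by (rule is_ess_inf_lower[OF g(1) h])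
    then show ?thesis using \<gamma> \<eta> by eventually_elim (use less in auto)
  qed
  then have "AE \<omega> in P. ?g \<omega> \<le> g \<omega>" by (rule is_ess_inf_greatest[OF g(1) meas])
  then have "AE \<omega> in P. history t \<omega> \<noteq> y" by eventually_elim (use \<epsilon> in \<open>auto split: if_splits\<close>)
  then have "AE \<omega> in P. history t \<omega> = y \<longrightarrow> h \<omega> \<le> g \<omega> + \<epsilon>" for h by eventually_elim simp
  with no S show False by blast
qed

section \<open>Pasting two measures at time \<open>t\<close>\<close>

lemma cexp_agree:
  assumes Q: "equivalent_prob P Q" "equivalent_prob P Q'" and t: "s \<le> t" "t \<le> T"
    and eq: "\<forall>g :: 'a \<Rightarrow> real. adapted t g \<longrightarrow> (\<integral>\<omega>. g \<omega> \<partial>Q') = (\<integral>\<omega>. g \<omega> \<partial>Q)" and g: "adapted t g"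
  shows "AE \<omega> in P. cexp Q' s g \<omega> = cexp Q s g \<omega>"
proof (rule cexp_charact[OF Q(2)])
  have sT: "s \<le> T" using t by simp
  show "s \<le> T" "adapted s (cexp Q s g)" "adapted T g"
    using sT adapted_cexp adapted_mono[OF g t(2)] by auto
  fix A assume "A \<in> sets (filt P X s)"
  then have A: "adapted s (indicator A :: 'a \<Rightarrow> real)" by (rule adapted_indicator[OF _ sT])
  have "(\<integral>\<omega>. indicator A \<omega> * g \<omega> \<partial>Q') = (\<integral>\<omega>. indicator A \<omega> * g \<omega> \<partial>Q)"
    by (intro eq[rule_format] adapted_mult g adapted_mono[OF A t(1)])
  also have "\<dots> = (\<integral>\<omega>. indicator A \<omega> * cexp Q s g \<omega> \<partial>Q)"
    by (rule cexp_integral[symmetric, OF Q(1) sT A adapted_mono[OF g t(2)]])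
  also have "\<dots> = (\<integral>\<omega>. indicator A \<omega> * cexp Q s g \<omega> \<partial>Q')"
    by (intro eq[rule_format, symmetric] adapted_mult adapted_mono[OF A t(1)] adapted_mono[OF adapted_cexp[OF sT] t(1)])
  finally show "(\<integral>\<omega>. indicator A \<omega> * g \<omega> \<partial>Q') = (\<integral>\<omega>. indicator A \<omega> * cexp Q s g \<omega> \<partial>Q')" .
qed

text \<open>Pasting leaves the measure unchanged up to time \<open>t\<close> and switches the
  conditional law of the future to that of \<open>Q'\<close> on \<open>A\<close>. These two
  properties are all that dynamic programming uses of the formula for the pasted measure.\<close>

lemma pasting:
  assumes Q: "equivalent_prob P Q" "equivalent_prob P Q'" "equivalent_prob P Q''"
    and t: "t \<le> T" and A: "A \<in> sets (filt P X t)"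
    and paste: "\<forall>B\<in>sets P. measure Q'' B =
      (\<integral>\<omega>. indicator A \<omega> * cexp Q' t (indicator B) \<omega> + indicator (space P - A) \<omega> * indicator B \<omega> \<partial>Q)"
  shows "\<And>g :: 'a \<Rightarrow> real. adapted t g \<Longrightarrow> (\<integral>\<omega>. g \<omega> \<partial>Q'') = (\<integral>\<omega>. g \<omega> \<partial>Q)"
    and "\<And>g. adapted T g \<Longrightarrow>
      AE \<omega> in P. cexp Q'' t g \<omega> = (if \<omega> \<in> A then cexp Q' t g \<omega> else cexp Q t g \<omega>)"
proof -
  let ?I = "indicator A :: 'a \<Rightarrow> real" and ?J = "indicator (space P - A) :: 'a \<Rightarrow> real"
  have I: "adapted t ?I" by (rule adapted_indicator[OF A t])
  have "space P - A \<in> sets (filt P X t)" using sets.compl_sets[OF A] by (simp add: space_filt)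
  then have J: "adapted t ?J" by (rule adapted_indicator[OF _ t])
  have spaces: "space Q = space P" "space Q'' = space P"
    using Q by (auto simp: equivalent_prob_def dest: sets_eq_imp_space_eq)
  have integral_AE: "(\<integral>\<omega>. f \<omega> \<partial>R) = (\<integral>\<omega>. g \<omega> \<partial>R)"
    if "equivalent_prob P R" "adapted T g" "AE \<omega> in P. f \<omega> = g \<omega>" for R and f g :: "'a \<Rightarrow> real"
    using that adapted_measurable[OF that(2)] adapted_measurable[OF adapted_AE_cong[OF that(2,3)]]
    by (intro integral_cong_AE) (auto simp: AE_equivalent measurable_equivalent)
  \<comment> \<open>The hypothesis concerns events only. Almost surely a random variable is a finite
    combination of indicators of full paths, so linearity extends it to integrals.\<close>
  have integral_paste: "(\<integral>\<omega>. g \<omega> \<partial>Q'') = (\<integral>\<omega>. ?I \<omega> * cexp Q' t g \<omega> + ?J \<omega> * g \<omega> \<partial>Q)"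
    if g: "adapted T g" for g :: "'a \<Rightarrow> real"
  proof -
    obtain \<gamma> where \<gamma>: "AE \<omega> in P. g \<omega> = \<gamma> (history T \<omega>)" using g by (auto simp: adapted_def)
    define F where "F = history T ` space P"
    have F: "finite F" unfolding F_def by (rule finite_histories) simp
    define B where "B y = {\<omega>\<in>space P. history T \<omega> = y}" for y
    have B: "B y \<in> sets P" for y unfolding B_def by (rule history_event_P) simp
    let ?B = "\<lambda>y. indicator (B y) :: 'a \<Rightarrow> real"
    have aB: "adapted T (?B y)" for y
      using B by (intro adapted_P_real) auto
    have g_eq: "AE \<omega> in P. g \<omega> = (\<Sum>y\<in>F. \<gamma> y * ?B y \<omega>)"
      using \<gamma> AE_space
    proof eventually_elim
      case (elim \<omega>)
      have "(\<Sum>y\<in>F. \<gamma> y * ?B y \<omega>) = (\<Sum>y\<in>F. if y = history T \<omega> then \<gamma> y else 0)"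
        using elim by (intro sum.cong) (auto simp: B_def indicator_def)
      then show ?case using elim F by (simp add: F_def)
    qed
    have aS: "adapted T (\<lambda>\<omega>. \<Sum>y\<in>F. \<gamma> y * ?B y \<omega>)"
      by (intro adapted_sum F adapted_mult adapted_const aB)
    have "AE \<omega> in P. cexp Q' t (\<lambda>\<omega>. \<Sum>y\<in>F. \<gamma> y * ?B y \<omega>) \<omega> = (\<Sum>y\<in>F. \<gamma> y * cexp Q' t (?B y) \<omega>)"
      by (rule cexp_linear_comb[OF Q(2) t adapted_const aB F])
    then have eq: "AE \<omega> in P. ?I \<omega> * cexp Q' t g \<omega> + ?J \<omega> * g \<omega> =
        (\<Sum>y\<in>F. \<gamma> y * (?I \<omega> * cexp Q' t (?B y) \<omega> + ?J \<omega> * ?B y \<omega>))"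
      using cexp_cong[OF Q(2) t aS g_eq] g_eq
      by eventually_elim (simp add: sum_distrib_left sum.distrib algebra_simps)
    have a: "adapted T (\<lambda>\<omega>. ?I \<omega> * cexp Q' t (?B y) \<omega> + ?J \<omega> * ?B y \<omega>)" for y
      by (intro adapted_add adapted_mult aB adapted_mono[OF I t] adapted_mono[OF J t]
          adapted_mono[OF adapted_cexp[OF t] t])
    have "(\<integral>\<omega>. g \<omega> \<partial>Q'') = (\<integral>\<omega>. (\<Sum>y\<in>F. \<gamma> y * ?B y \<omega>) \<partial>Q'')"
      by (rule integral_AE[OF Q(3) aS g_eq])
    also have "\<dots> = (\<Sum>y\<in>F. \<gamma> y * measure Q'' (B y))"
      using adapted_integrable[OF Q(3) aB]
      by (subst Bochner_Integration.integral_sum) (auto simp: spaces B_def Int_def conj_commute)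
    also have "\<dots> = (\<Sum>y\<in>F. \<gamma> y * (\<integral>\<omega>. ?I \<omega> * cexp Q' t (?B y) \<omega> + ?J \<omega> * ?B y \<omega> \<partial>Q))"
      by (simp only: paste[rule_format, OF B])
    also have "\<dots> = (\<integral>\<omega>. (\<Sum>y\<in>F. \<gamma> y * (?I \<omega> * cexp Q' t (?B y) \<omega> + ?J \<omega> * ?B y \<omega>)) \<partial>Q)"
      using adapted_integrable[OF Q(1) a order_refl]
      by (subst Bochner_Integration.integral_sum) auto
    also have "\<dots> = (\<integral>\<omega>. ?I \<omega> * cexp Q' t g \<omega> + ?J \<omega> * g \<omega> \<partial>Q)"
      by (rule integral_AE[symmetric, OF Q(1) _ eq]) (intro adapted_sum F adapted_mult adapted_const a)
    finally show ?thesis .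
  qed
  show agree: "(\<integral>\<omega>. g \<omega> \<partial>Q'') = (\<integral>\<omega>. g \<omega> \<partial>Q)" if g: "adapted t g" for g :: "'a \<Rightarrow> real"
  proof -
    have gT: "adapted T g" by (rule adapted_mono[OF g t])
    have "AE \<omega> in P. ?I \<omega> * cexp Q' t g \<omega> + ?J \<omega> * g \<omega> = g \<omega>"
      using cexp_adapted[OF Q(2) t g] AE_space by eventually_elim (auto simp: indicator_def)
    from integral_AE[OF Q(1) gT this] show ?thesis unfolding integral_paste[OF gT] .
  qed
  fix g :: "'a \<Rightarrow> real" assume g: "adapted T g"
  let ?h = "\<lambda>\<omega>. ?I \<omega> * cexp Q' t g \<omega> + ?J \<omega> * cexp Q t g \<omega>"
  have h: "adapted t ?h" by (intro adapted_add adapted_mult I J adapted_cexp t)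
  have "AE \<omega> in P. cexp Q'' t g \<omega> = ?h \<omega>"
  proof (rule cexp_charact[OF Q(3) t h g])
    fix B assume "B \<in> sets (filt P X t)"
    then have aB: "adapted t (indicator B :: 'a \<Rightarrow> real)" by (rule adapted_indicator[OF _ t])
    let ?B = "indicator B :: 'a \<Rightarrow> real"
    have Bg: "adapted T (\<lambda>\<omega>. ?B \<omega> * g \<omega>)" by (intro adapted_mult g adapted_mono[OF aB t])
    have JB: "adapted t (\<lambda>\<omega>. ?J \<omega> * ?B \<omega>)" by (intro adapted_mult J aB)
    have a: "adapted T (\<lambda>\<omega>. ?I \<omega> * (?B \<omega> * cexp Q' t g \<omega>))"
      by (rule adapted_mono[OF _ t]) (intro adapted_mult I aB adapted_cexp t)
    have b: "adapted T (\<lambda>\<omega>. (?J \<omega> * ?B \<omega>) * g \<omega>)" "adapted T (\<lambda>\<omega>. (?J \<omega> * ?B \<omega>) * cexp Q t g \<omega>)"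
      by (intro adapted_mult g adapted_mono[OF JB t] adapted_mono[OF adapted_cexp[OF t] t])+
    note int = adapted_integrable[OF Q(1) _ order_refl]
    have "(\<integral>\<omega>. ?B \<omega> * g \<omega> \<partial>Q'') = (\<integral>\<omega>. ?I \<omega> * cexp Q' t (\<lambda>\<omega>. ?B \<omega> * g \<omega>) \<omega> + ?J \<omega> * (?B \<omega> * g \<omega>) \<partial>Q)"
      by (rule integral_paste[OF Bg])
    also have "\<dots> = (\<integral>\<omega>. ?I \<omega> * (?B \<omega> * cexp Q' t g \<omega>) + (?J \<omega> * ?B \<omega>) * g \<omega> \<partial>Q)"
      by (rule integral_AE[OF Q(1) adapted_add[OF a b(1)]])
         (use cexp_mult[OF Q(2) t aB g] in \<open>eventually_elim, simp\<close>)
    also have "\<dots> = (\<integral>\<omega>. ?I \<omega> * (?B \<omega> * cexp Q' t g \<omega>) \<partial>Q) + (\<integral>\<omega>. (?J \<omega> * ?B \<omega>) * g \<omega> \<partial>Q)"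
      by (rule Bochner_Integration.integral_add[OF int[OF a] int[OF b(1)]])
    also have "(\<integral>\<omega>. (?J \<omega> * ?B \<omega>) * g \<omega> \<partial>Q) = (\<integral>\<omega>. (?J \<omega> * ?B \<omega>) * cexp Q t g \<omega> \<partial>Q)"
      by (rule cexp_integral[symmetric, OF Q(1) t JB g])
    also have "(\<integral>\<omega>. ?I \<omega> * (?B \<omega> * cexp Q' t g \<omega>) \<partial>Q) + \<dots> =
        (\<integral>\<omega>. ?I \<omega> * (?B \<omega> * cexp Q' t g \<omega>) + (?J \<omega> * ?B \<omega>) * cexp Q t g \<omega> \<partial>Q)"
      by (rule Bochner_Integration.integral_add[symmetric, OF int[OF a] int[OF b(2)]])
    also have "\<dots> = (\<integral>\<omega>. ?B \<omega> * ?h \<omega> \<partial>Q)"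
      by (simp add: algebra_simps)
    also have "\<dots> = (\<integral>\<omega>. ?B \<omega> * ?h \<omega> \<partial>Q'')"
      by (intro agree[symmetric] adapted_mult aB h)
    finally show "(\<integral>\<omega>. ?B \<omega> * g \<omega> \<partial>Q'') = (\<integral>\<omega>. ?B \<omega> * ?h \<omega> \<partial>Q'')" .
  qed
  then show "AE \<omega> in P. cexp Q'' t g \<omega> = (if \<omega> \<in> A then cexp Q' t g \<omega> else cexp Q t g \<omega>)"
    using AE_space by eventually_elim (auto simp: indicator_def)
qed

end

section \<open>The backward equation\<close>

context finite_state_process
begin

section \<open>Dynamic programming\<close>

lemma finite_min_pasting:
  assumes \<Lambda>: "\<forall>Q\<in>\<Lambda>. equivalent_prob P Q" "time_consistent P X T \<Lambda>"
    and \<xi>: "adapted T \<xi>" and Y: "is_nonlinear_expectation P X T \<Lambda> \<xi> Y"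
    and t: "t \<le> T" and Q: "Q \<in> \<Lambda>" and \<epsilon>: "\<epsilon> > 0"
  obtains Q' where "Q' \<in> \<Lambda>"
    "\<forall>g :: 'a \<Rightarrow> real. adapted t g \<longrightarrow> (\<integral>\<omega>. g \<omega> \<partial>Q') = (\<integral>\<omega>. g \<omega> \<partial>Q)"
    "AE \<omega> in P. cexp Q' t \<xi> \<omega> \<le> Y t \<omega> + \<epsilon>"
proof -
  have Yt: "adapted t (Y t)" "is_ess_inf P {cexp Q t \<xi> | Q. Q \<in> \<Lambda>} (Y t)"
    using Y t by (auto simp: is_nonlinear_expectation_def intro!: adapted_filt_real)
  \<comment> \<open>Time consistency combines two measures at a time, so the histories are treated
    one by one: a near-minimiser for \<open>y\<close> is pasted into the measure already good on
    \<open>K\<close>. Agreement with \<open>Q\<close> on F_t survives every pasting.\<close>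
  have "\<exists>Q'\<in>\<Lambda>. (\<forall>g :: 'a \<Rightarrow> real. adapted t g \<longrightarrow> (\<integral>\<omega>. g \<omega> \<partial>Q') = (\<integral>\<omega>. g \<omega> \<partial>Q)) \<and>
      (AE \<omega> in P. history t \<omega> \<in> K \<longrightarrow> cexp Q' t \<xi> \<omega> \<le> Y t \<omega> + \<epsilon>)" if "finite K" for K
    using that
  proof induction
    case empty
    then show ?case using Q by auto
  next
    case (insert y K)
    then obtain Q1 where Q1: "Q1 \<in> \<Lambda>"
      "\<forall>g :: 'a \<Rightarrow> real. adapted t g \<longrightarrow> (\<integral>\<omega>. g \<omega> \<partial>Q1) = (\<integral>\<omega>. g \<omega> \<partial>Q)"
      "AE \<omega> in P. history t \<omega> \<in> K \<longrightarrow> cexp Q1 t \<xi> \<omega> \<le> Y t \<omega> + \<epsilon>" by blast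
    have "\<exists>h\<in>{cexp Q t \<xi> | Q. Q \<in> \<Lambda>}. AE \<omega> in P. history t \<omega> = y \<longrightarrow> h \<omega> \<le> Y t \<omega> + \<epsilon>"
      by (rule ess_inf_approx[OF t _ _ Yt(2,1) \<epsilon>]) (use Q adapted_cexp[OF t] in auto)
    then obtain Q2 where Q2: "Q2 \<in> \<Lambda>" "AE \<omega> in P. history t \<omega> = y \<longrightarrow> cexp Q2 t \<xi> \<omega> \<le> Y t \<omega> + \<epsilon>" by blast
    define A where "A = {\<omega>\<in>space P. history t \<omega> = y}"
    have A: "A \<in> sets (filt P X t)" unfolding A_def by (rule history_event[OF t])
    obtain Q3 where Q3: "Q3 \<in> \<Lambda>" "\<forall>B\<in>sets P. measure Q3 B =
          (\<integral>\<omega>. indicator A \<omega> * cexp Q2 t (indicator B) \<omega>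
               + indicator (space P - A) \<omega> * indicator B \<omega> \<partial>Q1)"
      using \<Lambda>(2) Q1(1) Q2(1) t A unfolding time_consistent_def by blast
    have eqv: "equivalent_prob P Q1" "equivalent_prob P Q2" "equivalent_prob P Q3"
      using \<Lambda>(1) Q1(1) Q2(1) Q3(1) by auto
    note p = pasting[OF eqv t A Q3(2)]
    have "AE \<omega> in P. history t \<omega> \<in> insert y K \<longrightarrow> cexp Q3 t \<xi> \<omega> \<le> Y t \<omega> + \<epsilon>"
      using p(2)[OF \<xi>] Q1(3) Q2(2) AE_space
      by eventually_elim (auto simp: A_def split: if_splits)
    with p(1) Q1(2) Q3(1) show ?case by auto
  qed
  from this[OF finite_histories[OF t]] obtain Q' where Q': "Q' \<in> \<Lambda>"
    "\<forall>g :: 'a \<Rightarrow> real. adapted t g \<longrightarrow> (\<integral>\<omega>. g \<omega> \<partial>Q') = (\<integral>\<omega>. g \<omega> \<partial>Q)"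
    "AE \<omega> in P. history t \<omega> \<in> history t ` space P \<longrightarrow> cexp Q' t \<xi> \<omega> \<le> Y t \<omega> + \<epsilon>" by blast
  show ?thesis
    by (rule that[OF Q'(1)]) (use Q'(2,3) AE_space in \<open>auto elim!: eventually_elim2\<close>)
qed

text \<open>With a nearly optimal \<open>Q'\<close> that agrees with \<open>Q\<close> up to time
  \<open>t\<close>, Y_s is at most the conditional \<open>Q'\<close>-mean of \<xi>, which by the
  tower property is at most that of Y_t plus the error; Y_t being an F_t-variable, \<open>Q'\<close>
  can be replaced by \<open>Q\<close>. The errors 1/(n+1) allow a common null set.\<close>

lemma dynamic_programming_le:
  assumes \<Lambda>: "\<forall>Q\<in>\<Lambda>. equivalent_prob P Q" "time_consistent P X T \<Lambda>"
    and \<xi>: "adapted T \<xi>" and Y: "is_nonlinear_expectation P X T \<Lambda> \<xi> Y"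
    and t: "s \<le> t" "t \<le> T" and Q: "Q \<in> \<Lambda>"
  shows "AE \<omega> in P. Y s \<omega> \<le> cexp Q s (Y t) \<omega>"
proof -
  have sT: "s \<le> T" using t by simp
  have Yt: "adapted t (Y t)"
    using Y t by (auto simp: is_nonlinear_expectation_def intro!: adapted_filt_real)
  note YtT = adapted_mono[OF Yt t(2)]
  have eQ: "equivalent_prob P Q" using \<Lambda> Q by blast
  have "AE \<omega> in P. Y s \<omega> \<le> cexp Q s (Y t) \<omega> + 1 / real (Suc n)" for n
  proof -
    let ?e = "1 / real (Suc n)"
    obtain Q' where Q': "Q' \<in> \<Lambda>"
      "\<forall>g :: 'a \<Rightarrow> real. adapted t g \<longrightarrow> (\<integral>\<omega>. g \<omega> \<partial>Q') = (\<integral>\<omega>. g \<omega> \<partial>Q)"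
      "AE \<omega> in P. cexp Q' t \<xi> \<omega> \<le> Y t \<omega> + ?e"
      by (rule finite_min_pasting[OF \<Lambda> \<xi> Y t(2) Q, of ?e]) auto
    have eQ': "equivalent_prob P Q'" using \<Lambda> Q' by blast
    have "AE \<omega> in P. Y s \<omega> \<le> cexp Q' s \<xi> \<omega>"
      using Y sT Q'(1) by (auto simp: is_nonlinear_expectation_def is_ess_inf_def)
    moreover note cexp_tower[OF eQ' t \<xi>]
      cexp_mono[OF eQ' sT adapted_mono[OF adapted_cexp[OF t(2)] t(2)] adapted_add[OF YtT adapted_const] Q'(3)]
      cexp_add[OF eQ' sT YtT adapted_const[of T ?e]]
      cexp_adapted[OF eQ' sT adapted_const[of s ?e]] cexp_agree[OF eQ eQ' t Q'(2) Yt]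
    ultimately show ?thesis by eventually_elim simp
  qed
  then have "AE \<omega> in P. \<forall>n. Y s \<omega> \<le> cexp Q s (Y t) \<omega> + 1 / real (Suc n)"
    by (simp only: AE_all_countable) simp
  then show ?thesis
  proof eventually_elim
    case (elim \<omega>)
    show ?case
    proof (rule field_le_epsilon)
      fix e :: real assume "e > 0"
      then obtain n where "1 / real (Suc n) < e" by (rule nat_approx_posE)
      with elim[rule_format, of n] show "Y s \<omega> \<le> cexp Q s (Y t) \<omega> + e" by linarith
    qed
  qed
qed

section \<open>Existence of the value process and of the driver\<close>

lemma nonlinear_expectation_exists:
  assumes "\<Lambda> \<noteq> {}" and \<Lambda>: "\<forall>Q\<in>\<Lambda>. equivalent_prob P Q" and \<xi>: "adapted T \<xi>"
  shows "\<exists>Y. is_nonlinear_expectation P X T \<Lambda> \<xi> Y"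
proof -
  obtain c where c: "AE \<omega> in P. norm (\<xi> \<omega>) \<le> c" using adapted_bounded[OF \<xi> order_refl] by blast
  have "\<exists>g. g \<in> borel_measurable (filt P X t) \<and> is_ess_inf P {cexp Q t \<xi> | Q. Q \<in> \<Lambda>} g"
    if t: "t \<le> T" for t
  proof (rule ess_inf_exists[OF t, of _ "- c"])
    fix h assume "h \<in> {cexp Q t \<xi> | Q. Q \<in> \<Lambda>}"
    then obtain Q where Q: "equivalent_prob P Q" "h = cexp Q t \<xi>" using \<Lambda> by blast
    show "adapted t h" unfolding Q by (rule adapted_cexp[OF t])
    have "AE \<omega> in P. - c \<le> \<xi> \<omega>" using c by eventually_elim auto
    from cexp_mono[OF Q(1) t adapted_const \<xi> this] cexp_adapted[OF Q(1) t adapted_const[of t "- c"]]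
    show "AE \<omega> in P. - c \<le> h \<omega>" unfolding Q by eventually_elim simp
  qed (use assms in auto)
  then have "\<forall>t\<in>{..T}. \<exists>g. g \<in> borel_measurable (filt P X t) \<and> is_ess_inf P {cexp Q t \<xi> | Q. Q \<in> \<Lambda>} g"
    by simp
  from bchoice[OF this] show ?thesis by (auto simp: is_nonlinear_expectation_def)
qed

text \<open>A lower bound uniform in \<theta> is needed. It comes from reading the inner product of
  z with \<theta>_t as the conditional mean, under the measure of \<theta>, of the inner product of
  z with the increment; that variable is essentially bounded and does not involve \<theta>.\<close>

lemma driver_exists:
  assumes "\<Lambda> \<noteq> {}" and \<Lambda>: "\<forall>Q\<in>\<Lambda>. equivalent_prob P Q"
  shows "\<exists>f. is_driver P X T \<Lambda> f"
proof -
  let ?S = "\<lambda>t z. {\<lambda>\<omega>. z \<bullet> \<theta> t \<omega> | \<theta>. Q_vector_process P X T \<theta> \<and> Q_measure P X T \<theta> \<in> \<Lambda>}"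
  have "\<exists>g. g \<in> borel_measurable (filt P X t) \<and> is_ess_inf P (?S t z) g" if t: "t < T" for t z
  proof -
    have tT: "t \<le> T" "Suc t \<le> T" using t by auto
    let ?M = "\<lambda>i \<omega>. M_diff P X (Suc t) \<omega> $ i"
    have M: "adapted T (?M i)" for i by (rule adapted_M_diff_nth[OF t tT(2)])
    have zM: "adapted T (\<lambda>\<omega>. \<Sum>i\<in>UNIV. z $ i * ?M i \<omega>)"
      by (intro adapted_sum finite adapted_mult adapted_const M)
    obtain c where c: "AE \<omega> in P. norm (\<Sum>i\<in>UNIV. z $ i * ?M i \<omega>) \<le> c"
      using adapted_bounded[OF zM order_refl] by blast
    show ?thesis
    proof (rule ess_inf_exists[OF tT(1), of _ "- c"])
      obtain Q \<theta> where "Q \<in> \<Lambda>" "Q_vector_process P X T \<theta>" "Q_measure P X T \<theta> = Q"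
        using assms Q_measure_surj by (metis all_not_in_conv)
      then show "?S t z \<noteq> {}" by blast
      fix h assume "h \<in> ?S t z"
      then obtain \<theta> where \<theta>: "Q_vector_process P X T \<theta>" "equivalent_prob P (Q_measure P X T \<theta>)"
        and h: "h = (\<lambda>\<omega>. z \<bullet> \<theta> t \<omega>)" using \<Lambda> by blast
      show "adapted t h" unfolding h
        by (rule adapted_comp[OF Q_vector_process_adapted[OF \<theta>(1) t]])
      have "AE \<omega> in P. \<forall>i\<in>UNIV. cexp (Q_measure P X T \<theta>) t (?M i) \<omega> = \<theta> t \<omega> $ i"
        by (intro AE_finite_allI Q_measure_cexp_M_diff \<theta> t finite)
      moreover have "AE \<omega> in P. cexp (Q_measure P X T \<theta>) t (\<lambda>\<omega>. \<Sum>i\<in>UNIV. z $ i * ?M i \<omega>) \<omega>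
         = (\<Sum>i\<in>UNIV. z $ i * cexp (Q_measure P X T \<theta>) t (?M i) \<omega>)"
        by (rule cexp_linear_comb[OF \<theta>(2) tT(1) adapted_const M finite])
      moreover have "AE \<omega> in P. - c \<le> (\<Sum>i\<in>UNIV. z $ i * ?M i \<omega>)" using c by eventually_elim auto
      note cexp_mono[OF \<theta>(2) tT(1) adapted_const zM this] cexp_adapted[OF \<theta>(2) tT(1) adapted_const[of t "- c"]]
      ultimately show "AE \<omega> in P. - c \<le> h \<omega>" unfolding h
        by eventually_elim (simp add: inner_vec_def)
    qed
  qed
  then have "\<forall>t\<in>{..<T}. \<exists>f. \<forall>z. f z \<in> borel_measurable (filt P X t) \<and> is_ess_inf P (?S t z) (f z)"
    by (intro ballI choice) simp
  from bchoice[OF this] obtain f where f: "\<forall>t\<in>{..<T}. \<forall>z. f t z \<in> borel_measurable (filt P X t) \<and> is_ess_inf P (?S t z) (f t z)"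
    by blast
  then have "is_driver P X T \<Lambda> (\<lambda>\<omega> t z. f t z \<omega>)"
    by (simp add: is_driver_def)
  then show ?thesis by blast
qed

section \<open>Terminal value and one-step equation\<close>

lemma nonlinear_expectation_terminal:
  assumes "\<Lambda> \<noteq> {}" and \<Lambda>: "\<forall>Q\<in>\<Lambda>. equivalent_prob P Q" and \<xi>: "adapted T \<xi>"
    and Y: "is_nonlinear_expectation P X T \<Lambda> \<xi> Y"
  shows "AE \<omega> in P. Y T \<omega> = \<xi> \<omega>"
proof -
  have YT: "is_ess_inf P {cexp Q T \<xi> | Q. Q \<in> \<Lambda>} (Y T)" using Y by (simp add: is_nonlinear_expectation_def)
  have eq: "AE \<omega> in P. cexp Q T \<xi> \<omega> = \<xi> \<omega>" if "Q \<in> \<Lambda>" for Q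
    using cexp_adapted[OF _ order_refl \<xi>] \<Lambda> that by blast
  obtain Q where Q: "Q \<in> \<Lambda>" using assms by blast
  have "AE \<omega> in P. Y T \<omega> \<le> cexp Q T \<xi> \<omega>" using YT Q by (auto simp: is_ess_inf_def)
  moreover have "AE \<omega> in P. \<xi> \<omega> \<le> cexp Q T \<xi> \<omega>" if "Q \<in> \<Lambda>" for Q
    using eq[OF that] by eventually_elim simp
  then have "AE \<omega> in P. \<xi> \<omega> \<le> Y T \<omega>"
    by (intro is_ess_inf_greatest[OF YT adapted_measurable[OF \<xi> order_refl]]) blast
  moreover note eq[OF Q]
  ultimately show ?thesis by eventually_elim simp
qed

lemma one_step_equation:
  assumes \<Lambda>: "\<forall>Q\<in>\<Lambda>. equivalent_prob P Q" "time_consistent P X T \<Lambda>"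
    and \<xi>: "adapted T \<xi>" and Y: "is_nonlinear_expectation P X T \<Lambda> \<xi> Y"
    and f: "is_driver P X T \<Lambda> f" and t: "t < T"
  obtains Z where "Z \<in> borel_measurable (filt P X t)"
    "AE \<omega> in P. Y t \<omega> = Y (Suc t) \<omega> + f \<omega> t (Z \<omega>) - Z \<omega> \<bullet> M_diff P X (Suc t) \<omega>"
proof -
  have tT: "t \<le> T" "Suc t \<le> T" using t by auto
  let ?S = "\<lambda>z. {\<lambda>\<omega>. z \<bullet> \<theta> t \<omega> | \<theta>. Q_vector_process P X T \<theta> \<and> Q_measure P X T \<theta> \<in> \<Lambda>}"
  have f_inf: "is_ess_inf P (?S z) (\<lambda>\<omega>. f \<omega> t z)" and f_ad: "adapted t (\<lambda>\<omega>. f \<omega> t z)" for z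
    using f t by (auto simp: is_driver_def intro!: adapted_filt_real)
  have Y_ad: "adapted s (Y s)" and Y_inf: "is_ess_inf P {cexp Q s \<xi> | Q. Q \<in> \<Lambda>} (Y s)"
    if "s \<le> T" for s
    using Y that by (auto simp: is_nonlinear_expectation_def intro!: adapted_filt_real)
  let ?Y = "Y (Suc t)" and ?e = "cexp P t (Y (Suc t))"
  let ?M = "\<lambda>i \<omega>. M_diff P X (Suc t) \<omega> $ i"
  have M: "adapted T (?M i)" for i by (rule adapted_M_diff_nth[OF t tT(2)])
  have e: "adapted t ?e" by (rule adapted_cexp[OF tT(1)])
  obtain \<zeta> where \<zeta>: "AE \<omega> in P. ?Y \<omega> - ?e \<omega> = \<zeta> (history t \<omega>) \<bullet> M_diff P X (Suc t) \<omega>"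
    by (rule martingale_representation[OF t Y_ad[OF tT(2)]])
  define Z where "Z \<omega> = \<zeta> (history t \<omega>)" for \<omega>
  have Z: "adapted t (\<lambda>\<omega>. Z \<omega> $ i)" for i
    unfolding Z_def by (rule adapted_comp[OF adapted_history])
  have step: "AE \<omega> in P. cexp (Q_measure P X T \<theta>) t ?Y \<omega> = ?e \<omega> + Z \<omega> \<bullet> \<theta> t \<omega>"
    if \<theta>: "Q_vector_process P X T \<theta>" "Q_measure P X T \<theta> \<in> \<Lambda>" for \<theta>
  proof -
    let ?Q = "Q_measure P X T \<theta>"
    have Q: "equivalent_prob P ?Q" using \<theta> \<Lambda> by blast
    have eq: "AE \<omega> in P. ?Y \<omega> = ?e \<omega> + (\<Sum>i\<in>UNIV. Z \<omega> $ i * ?M i \<omega>)"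
      using \<zeta> by eventually_elim (simp add: Z_def inner_vec_def)
    have a: "adapted T (\<lambda>\<omega>. \<Sum>i\<in>UNIV. Z \<omega> $ i * ?M i \<omega>)"
      by (intro adapted_sum finite adapted_mult M adapted_mono[OF Z tT(1)])
    have eT: "adapted T ?e" by (rule adapted_mono[OF e tT(1)])
    have "AE \<omega> in P. \<forall>i\<in>UNIV. cexp ?Q t (?M i) \<omega> = \<theta> t \<omega> $ i"
      by (intro AE_finite_allI Q_measure_cexp_M_diff \<theta> Q t finite)
    moreover have "AE \<omega> in P. cexp ?Q t (\<lambda>\<omega>. \<Sum>i\<in>UNIV. Z \<omega> $ i * ?M i \<omega>) \<omega>
       = (\<Sum>i\<in>UNIV. Z \<omega> $ i * cexp ?Q t (?M i) \<omega>)"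
      by (rule cexp_linear_comb[OF Q tT(1) Z M finite])
    moreover note cexp_cong[OF Q tT(1) adapted_add[OF eT a] eq] cexp_add[OF Q tT(1) eT a]
      cexp_adapted[OF Q tT(1) e]
    ultimately show ?thesis by eventually_elim (simp add: inner_vec_def)
  qed
  have "AE \<omega> in P. Y t \<omega> - ?e \<omega> \<le> f \<omega> t (Z \<omega>)"
  proof -
    have "AE \<omega> in P. history t \<omega> = y \<longrightarrow> Y t \<omega> - ?e \<omega> \<le> f \<omega> t (\<zeta> y)" for y
    proof -
      \<comment> \<open>Localisation to one history: off \<open>y\<close> the candidate is the
        driver at \<open>\<zeta> y\<close> itself, hence a lower bound there, and on
        \<open>y\<close> it is the quantity to be compared. Maximality of the essential infimum then
        gives the inequality on \<open>y\<close>.\<close>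
      let ?g = "\<lambda>\<omega>. if history t \<omega> = y then Y t \<omega> - ?e \<omega> else f \<omega> t (\<zeta> y)"
      have "adapted t ?g"
        using adapted_comp2[OF adapted_history adapted_comp2[OF adapted_diff[OF Y_ad[OF tT(1)] e] f_ad[of "\<zeta> y"], of Pair],
          of "\<lambda>h (a, b). if h = y then a else b"] by simp
      then have meas: "?g \<in> borel_measurable P" by (rule adapted_measurable[OF _ tT(1)])
      have "AE \<omega> in P. ?g \<omega> \<le> h \<omega>" if hS: "h \<in> ?S (\<zeta> y)" for h
      proof -
        obtain \<theta> where \<theta>: "Q_vector_process P X T \<theta>" "Q_measure P X T \<theta> \<in> \<Lambda>"
          and h: "h = (\<lambda>\<omega>. \<zeta> y \<bullet> \<theta> t \<omega>)" using hS by blast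
        have "AE \<omega> in P. f \<omega> t (\<zeta> y) \<le> h \<omega>" by (rule is_ess_inf_lower[OF f_inf hS])
        moreover have "AE \<omega> in P. Y t \<omega> \<le> cexp (Q_measure P X T \<theta>) t ?Y \<omega>"
          by (rule dynamic_programming_le[OF \<Lambda> \<xi> Y _ tT(2) \<theta>(2)]) simp
        moreover note step[OF \<theta>]
        ultimately show ?thesis by eventually_elim (auto simp: h Z_def)
      qed
      then have "AE \<omega> in P. ?g \<omega> \<le> f \<omega> t (\<zeta> y)"
        by (rule is_ess_inf_greatest[OF f_inf meas])
      then show ?thesis by eventually_elim auto
    qed
    then have "AE \<omega> in P. \<forall>y\<in>history t ` space P. history t \<omega> = y \<longrightarrow> Y t \<omega> - ?e \<omega> \<le> f \<omega> t (\<zeta> y)"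
      by (intro AE_finite_allI finite_histories tT)
    with AE_space show ?thesis by eventually_elim (auto simp: Z_def)
  qed
  moreover have "AE \<omega> in P. f \<omega> t (Z \<omega>) + ?e \<omega> \<le> Y t \<omega>"
  proof -
    let ?F = "history t ` space P"
    have F: "finite ?F" by (rule finite_histories[OF tT(1)])
    \<comment> \<open>The driver is adapted for each fixed z only. Collecting its values at the
      finitely many points \<open>\<zeta> y\<close> and evaluating at the current history gives
      adaptedness of the driver along \<open>Z\<close>.\<close>
    have "adapted t (\<lambda>\<omega>. restrict (\<lambda>y. f \<omega> t (\<zeta> y)) ?F)"
      by (rule adapted_finite[OF F f_ad])
    from adapted_comp2[OF this adapted_history, of "\<lambda>\<phi> y. \<phi> y"]
    have "adapted t (\<lambda>\<omega>. restrict (\<lambda>y. f \<omega> t (\<zeta> y)) ?F (history t \<omega>))" .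
    then have "adapted t (\<lambda>\<omega>. f \<omega> t (Z \<omega>))"
      by (rule adapted_AE_cong) (use AE_space in \<open>eventually_elim, auto simp: Z_def\<close>)
    then have meas: "(\<lambda>\<omega>. f \<omega> t (Z \<omega>) + ?e \<omega>) \<in> borel_measurable P"
      by (rule adapted_measurable[OF adapted_add[OF _ e] tT(1)])
    \<comment> \<open>Writing \<open>Q\<close> through its vector process, the left side is at most
      the conditional \<open>Q\<close>-mean of Y_(t+1), which is at most that of the conditional
      expectation of \<xi> at time t+1; the tower property finishes.\<close>
    have "AE \<omega> in P. f \<omega> t (Z \<omega>) + ?e \<omega> \<le> h \<omega>" if hS: "h \<in> {cexp Q t \<xi> | Q. Q \<in> \<Lambda>}" for h
    proof -
      obtain Q where Q: "Q \<in> \<Lambda>" "equivalent_prob P Q" and h: "h = cexp Q t \<xi>" using hS \<Lambda> by blast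
      obtain \<theta> where \<theta>: "Q_vector_process P X T \<theta>" "Q_measure P X T \<theta> = Q"
        by (rule Q_measure_surj[OF Q(2)])
      have "AE \<omega> in P. \<forall>y\<in>?F. f \<omega> t (\<zeta> y) \<le> \<zeta> y \<bullet> \<theta> t \<omega>"
      proof (intro AE_finite_allI F)
        fix y
        have "(\<lambda>\<omega>. \<zeta> y \<bullet> \<theta> t \<omega>) \<in> ?S (\<zeta> y)" using \<theta> Q by blast
        then show "AE \<omega> in P. f \<omega> t (\<zeta> y) \<le> \<zeta> y \<bullet> \<theta> t \<omega>"
          by (rule is_ess_inf_lower[OF f_inf])
      qed
      moreover have "AE \<omega> in P. cexp Q t ?Y \<omega> = ?e \<omega> + Z \<omega> \<bullet> \<theta> t \<omega>"
        using step[of \<theta>] \<theta> Q by simp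
      moreover have "AE \<omega> in P. ?Y \<omega> \<le> cexp Q (Suc t) \<xi> \<omega>"
        using Y_inf[OF tT(2)] Q(1) by (auto simp: is_ess_inf_def)
      note cexp_mono[OF Q(2) tT(1) adapted_mono[OF Y_ad[OF tT(2)] tT(2)]
          adapted_mono[OF adapted_cexp[OF tT(2)] tT(2)] this]
      moreover have "AE \<omega> in P. cexp Q t (cexp Q (Suc t) \<xi>) \<omega> = cexp Q t \<xi> \<omega>"
        by (rule cexp_tower[OF Q(2) _ tT(2) \<xi>]) simp
      ultimately show ?thesis using AE_space
        by eventually_elim (force simp: h Z_def)
    qed
    then show ?thesis by (rule is_ess_inf_greatest[OF Y_inf[OF tT(1)] meas])
  qed
  ultimately have "AE \<omega> in P. Y t \<omega> = ?Y \<omega> + f \<omega> t (Z \<omega>) - Z \<omega> \<bullet> M_diff P X (Suc t) \<omega>"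
    using \<zeta> by eventually_elim (simp add: Z_def)
  moreover have "Z \<in> borel_measurable (filt P X t)"
    unfolding Z_def[abs_def] by (rule history_measurable_filt[OF tT(1)])
  ultimately show ?thesis by (rule that[rotated])
qed

end

text \<open>The equation is asserted for all versions of the value process and of the driver; the
  two existence claims ensure that this quantification is not vacuous.\<close>

theorem proposition3p9:
  fixes P :: "'a measure"
    and X :: "nat \<Rightarrow> 'a \<Rightarrow> real^'m"
    and T :: nat
    and \<Lambda> :: "'a measure set"
    and \<xi> :: "'a \<Rightarrow> real"
  assumes "finite_state_process P X T"
    and "\<Lambda> \<noteq> {}"
    and "\<forall>Q\<in>\<Lambda>. equivalent_prob P Q"
    and "time_consistent P X T \<Lambda>"
    and "integrable P \<xi>"
  shows "(\<exists>Y. is_nonlinear_expectation P X T \<Lambda> \<xi> Y) \<and>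
    (\<exists>f. is_driver P X T \<Lambda> f) \<and>
    (\<forall>Y f. is_nonlinear_expectation P X T \<Lambda> \<xi> Y \<longrightarrow> is_driver P X T \<Lambda> f \<longrightarrow>
      (\<exists>Z :: nat \<Rightarrow> 'a \<Rightarrow> real^'m.
        (\<forall>t<T. Z t \<in> borel_measurable (filt P X t)) \<and>
        (\<forall>t\<le>T. AE \<omega> in P.
          Y t \<omega> = \<xi> \<omega> + (\<Sum>u\<in>{t..<T}. f \<omega> u (Z u \<omega>))
                      - (\<Sum>u\<in>{t..<T}. Z u \<omega> \<bullet> M_diff P X (Suc u) \<omega>))))"
proof -
  interpret finite_state_process P X T by fact
  have \<xi>: "adapted T \<xi>" using assms(5) by (intro adapted_P_real) auto
  show ?thesis
  proof (intro conjI allI impI)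
    show "\<exists>Y. is_nonlinear_expectation P X T \<Lambda> \<xi> Y"
      by (rule nonlinear_expectation_exists[OF assms(2,3) \<xi>])
    show "\<exists>f. is_driver P X T \<Lambda> f" by (rule driver_exists[OF assms(2,3)])
    fix Y f assume Y: "is_nonlinear_expectation P X T \<Lambda> \<xi> Y" and f: "is_driver P X T \<Lambda> f"
    have "\<forall>t\<in>{..<T}. \<exists>Z. Z \<in> borel_measurable (filt P X t) \<and>
      (AE \<omega> in P. Y t \<omega> = Y (Suc t) \<omega> + f \<omega> t (Z \<omega>) - Z \<omega> \<bullet> M_diff P X (Suc t) \<omega>)"
    proof
      fix t assume "t \<in> {..<T}"
      then have "t < T" by simp
      from one_step_equation[OF assms(3,4) \<xi> Y f this] show "\<exists>Z. Z \<in> borel_measurable (filt P X t) \<and>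
        (AE \<omega> in P. Y t \<omega> = Y (Suc t) \<omega> + f \<omega> t (Z \<omega>) - Z \<omega> \<bullet> M_diff P X (Suc t) \<omega>)" by blast
    qed
    from bchoice[OF this] obtain Z where Z: "\<forall>t\<in>{..<T}. Z t \<in> borel_measurable (filt P X t) \<and>
      (AE \<omega> in P. Y t \<omega> = Y (Suc t) \<omega> + f \<omega> t (Z t \<omega>) - Z t \<omega> \<bullet> M_diff P X (Suc t) \<omega>)" by blast
    have "AE \<omega> in P. Y t \<omega> = \<xi> \<omega> + (\<Sum>u\<in>{t..<T}. f \<omega> u (Z u \<omega>))
                      - (\<Sum>u\<in>{t..<T}. Z u \<omega> \<bullet> M_diff P X (Suc u) \<omega>)" if "t \<le> T" for t
      using that
    proof (induction t rule: inc_induct)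
      case base
      show ?case using nonlinear_expectation_terminal[OF assms(2,3) \<xi> Y] by simp
    next
      case (step n)
      then have "AE \<omega> in P. Y n \<omega> = Y (Suc n) \<omega> + f \<omega> n (Z n \<omega>) - Z n \<omega> \<bullet> M_diff P X (Suc n) \<omega>"
        using Z by simp
      with step.IH show ?case
        by eventually_elim (use step.hyps in \<open>simp add: sum.atLeast_Suc_lessThan\<close>)
    qed
    with Z show "\<exists>Z :: nat \<Rightarrow> 'a \<Rightarrow> real^'m. (\<forall>t<T. Z t \<in> borel_measurable (filt P X t)) \<and>
        (\<forall>t\<le>T. AE \<omega> in P. Y t \<omega> = \<xi> \<omega> + (\<Sum>u\<in>{t..<T}. f \<omega> u (Z u \<omega>))
                      - (\<Sum>u\<in>{t..<T}. Z u \<omega> \<bullet> M_diff P X (Suc u) \<omega>))"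
      by (intro exI[of _ Z]) auto
  qed
qed

end
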